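(* Let $\alpha>0$, $\beta\in\mathbb{R}$ and $k\in[0,1)$. Suppose $f\in\mathcal{A}$ is such that the expression below is defined and finite for all $z\in\mathbb{D}$ (with $zf'(z)/f(z):=1$ at $z=0$) and $$\left|1+\frac{zf''(z)}{f'(z)}+(\alpha+i\beta-1)\frac{zf'(z)}{f(z)}-\frac{\alpha^2+\beta^2}{\alpha}\right|\le M\qquad(z\in\mathbb{D}),$$ where $M=k$ if $\alpha<\alpha^2+\beta^2$ and $M=k(\alpha^2+\beta^2)/\alpha$ if $\alpha^2+\beta^2\le\alpha$. Then $f$ is a Bazilevič function of type $(\alpha,\beta)$ and $f$ extends to a $\tilde k$-quasiconformal automorphism of $\mathbb{C}$, where $$\tilde k=\frac{2k\alpha+(1-k^2)|\beta|}{(1+k^2)\alpha+(1-k^2)\sqrt{\alpha^2+\beta^2}}.$$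
   Context: $\mathbb{D}=\{z\in\mathbb{C}:|z|<1\}$. $\mathcal{A}$ denotes the family of analytic functions $f$ on $\mathbb{D}$ of the form $f(z)=z+\sum_{n\ge2}a_nz^n$. A function $f\in\mathcal{A}$ is a Bazilevič function of type $(\alpha,\beta)$ if $$f(z)=\left[(\alpha+i\beta)\int_0^z g(\zeta)^\alpha h(\zeta)\zeta^{i\beta-1}\,d\zeta\right]^{1/(\alpha+i\beta)}$$ for some starlike univalent function $g\in\mathcal{A}$ and some analytic function $h$ on $\mathbb{D}$ with $h(0)=1$ and $\mathrm{Re}(e^{i\lambda}h)>0$ on $\mathbb{D}$ for some $\lambda\in\mathbb{R}$ (branches of powers chosen appropriately). A sense-preserving homeomorphism $F$ of a plane domain $G$ is $k$-quasiconformal ($0\le k<1$) if $F$ is absolutely continuous on almost all lines parallel to the coordinate axes and $|F_{\bar z}|\le k|F_z|$ almost everywhere in $G$; a $k$-quasiconformal automorphism of $\mathbb{C}$ extending $f$ is such a homeomorphism of $\mathbb{C}$ onto itself whose restriction to $\mathbb{D}$ is $f$. *)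

theory Defs
  imports "HOL-Analysis.Analysis"
begin

definition unit_disc :: "complex set" where
  "unit_disc = ball 0 1"

definition class_A :: "(complex \<Rightarrow> complex) \<Rightarrow> bool" where
  "class_A f \<longleftrightarrow> f holomorphic_on unit_disc \<and> f 0 = 0 \<and> deriv f 0 = 1"

definition starlike_univalent :: "(complex \<Rightarrow> complex) \<Rightarrow> bool" where
  "starlike_univalent g \<longleftrightarrow> class_A g \<and> inj_on g unit_disc \<and>
     (\<forall>w \<in> g ` unit_disc. closed_segment 0 w \<subseteq> g ` unit_disc)"

text \<open>Bazilevi\v{c} functions of type (alpha, beta).  The branches are fixed as follows:
  g(zeta)^alpha = exp(alpha * Lg zeta) * zeta powr alpha and
  f(z)^(alpha + i beta) = exp((alpha + i beta) * Lf z) * z powr (alpha + i beta),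
  where Lg, Lf are the holomorphic logarithms of g(z)/z, f(z)/z vanishing at 0,
  and zeta powr s is the principal power.  The integral from 0 to z is the line
  integral along the segment [0,z], parametrised by zeta = t z, t in [0,1].\<close>
definition bazilevich :: "real \<Rightarrow> real \<Rightarrow> (complex \<Rightarrow> complex) \<Rightarrow> bool" where
  "bazilevich \<alpha> \<beta> f \<longleftrightarrow> class_A f \<and>
     (\<exists>g h (lam::real) Lf Lg.
        starlike_univalent g \<and>
        h holomorphic_on unit_disc \<and> h 0 = 1 \<and>
        (\<forall>z\<in>unit_disc. Re (exp (\<i> * of_real lam) * h z) > 0) \<and>
        Lg holomorphic_on unit_disc \<and> Lg 0 = 0 \<and> (\<forall>z\<in>unit_disc. g z = z * exp (Lg z)) \<and>
        Lf holomorphic_on unit_disc \<and> Lf 0 = 0 \<and> (\<forall>z\<in>unit_disc. f z = z * exp (Lf z)) \<and>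
        (\<forall>z\<in>unit_disc.
           ((\<lambda>t::real.
               (exp (of_real \<alpha> * Lg (of_real t * z)) * (of_real t * z) powr of_real \<alpha>)
               * h (of_real t * z)
               * (of_real t * z) powr (\<i> * of_real \<beta> - 1) * z)
            has_integral
              (exp (Complex \<alpha> \<beta> * Lf z) * z powr Complex \<alpha> \<beta> / Complex \<alpha> \<beta>)) {0..1}))"

definition abs_continuous_on :: "real \<Rightarrow> real \<Rightarrow> (real \<Rightarrow> complex) \<Rightarrow> bool" where
  "abs_continuous_on a b \<phi> \<longleftrightarrow>
     (\<forall>\<epsilon>>0. \<exists>\<delta>>0. \<forall>(n::nat) (l::nat \<Rightarrow> real) (u::nat \<Rightarrow> real).
        (\<forall>i<n. a \<le> l i \<and> l i \<le> u i \<and> u i \<le> b) \<and>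
        (\<forall>i<n. \<forall>j<n. i \<noteq> j \<longrightarrow> u i \<le> l j \<or> u j \<le> l i) \<and>
        (\<Sum>i<n. u i - l i) < \<delta>
        \<longrightarrow> (\<Sum>i<n. cmod (\<phi> (u i) - \<phi> (l i))) < \<epsilon>)"

definition ACL :: "(complex \<Rightarrow> complex) \<Rightarrow> bool" where
  "ACL F \<longleftrightarrow>
     (AE y in lebesgue. \<forall>a b. a \<le> b \<longrightarrow> abs_continuous_on a b (\<lambda>x. F (Complex x y))) \<and>
     (AE x in lebesgue. \<forall>a b. a \<le> b \<longrightarrow> abs_continuous_on a b (\<lambda>y. F (Complex x y)))"

text \<open>Sense-preserving (for a homeomorphism of the plane): the image of every positively
  oriented circle around z winds once positively around F z, expressed through a
  continuous choice of argument along the image loop.\<close>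
definition sense_preserving :: "(complex \<Rightarrow> complex) \<Rightarrow> bool" where
  "sense_preserving F \<longleftrightarrow>
     (\<forall>z (r::real). r > 0 \<longrightarrow>
        (\<exists>\<theta>::real \<Rightarrow> real. continuous_on {0..1} \<theta> \<and>
           (\<forall>t\<in>{0..1}. F (z + of_real r * exp (2 * of_real pi * \<i> * of_real t)) - F z
               = of_real (cmod (F (z + of_real r * exp (2 * of_real pi * \<i> * of_real t)) - F z))
                 * exp (\<i> * of_real (\<theta> t))) \<and>
           \<theta> 1 - \<theta> 0 = 2 * pi))"

text \<open>k-quasiconformal automorphism of the complex plane.  F_x and F_y are the partial
  derivatives; F_z = (F_x - i F_y)/2 and F_zbar = (F_x + i F_y)/2.\<close>
definition qc_automorphism :: "real \<Rightarrow> (complex \<Rightarrow> complex) \<Rightarrow> bool" where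
  "qc_automorphism k F \<longleftrightarrow>
     0 \<le> k \<and> k < 1 \<and>
     (\<exists>G. homeomorphism UNIV UNIV F G) \<and> sense_preserving F \<and> ACL F \<and>
     (AE p in lebesgue. \<exists>Fx Fy.
        ((\<lambda>t::real. F (p + of_real t)) has_vector_derivative Fx) (at 0) \<and>
        ((\<lambda>t::real. F (p + \<i> * of_real t)) has_vector_derivative Fy) (at 0) \<and>
        cmod ((Fx + \<i> * Fy) / 2) \<le> k * cmod ((Fx - \<i> * Fy) / 2))"

end

(*
  Put s = alpha + i beta, c = |s|^2 / alpha, and let L, l be the logarithms of f(z)/z and of
  f'(z) (f(z)/z)^(s-1).  In the variable u = log z the function W = f^s satisfies W''/W' = Q = s + z l',
  and in both cases of the definition of M the hypothesis implies |Q - c| <= k c.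

  Since W' = s z^s exp(l), f is Bazilevic of type (alpha, beta) with h = 1 and
  g = z exp(l / alpha), where z g'/g = (Q - i beta) / alpha has positive real part.

  Extension: p = s z f'/f = W'/W solves the Riccati equation z p' = p (Q - p), whence Re p > 0, and L, l
  are Lipschitz on the disc, so they extend to the closed disc.  For Re u > 0 the function W is continued by
  W(-conj u) + W'(-conj u) (exp(2 c Re u) - 1) / c.  Its complex dilatation has modulus
  (1 - exp(-2 c Re u)) |1 - Q / c| <= k, and the resulting map F is C^1 across the unit circle.  F is a proper
  local homeomorphism whose only zero is 0, hence a homeomorphism.  It is even k-quasiconformal, and
  k <= ktilde.
*)
theory Submission
  imports Defs "HOL-Complex_Analysis.Complex_Analysis"
begin

subsection \<open>Locally injective proper maps and quasiconformality\<close>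

text \<open>The continuation comes from osculation. At v = -conj u replace W by the solution w of
  w'' = c w' with the same value and first derivative there, and evaluate w at u; since u - v = 2 Re
  u, this is the formula above. If Q = c, it is W itself. In general the mismatch Q - c enters only
  the conjugate derivative, and linearly, which is why |Q - c| <= k c bounds the dilatation. The
  constant satisfies 1 / c = Re (1 / s). The ratio of the continued W at u to W(-conj u) grows like
  exp(2 c Re u), so its power 1 / s grows like exp(2 Re u); against f(1 / conj z), of order exp(-Re
  u), this leaves |F| of order |z|, so F is proper. Two obstacles shape the proof. W is not a
  function of z, since u + 2 pi i multiplies it by a constant; so only L, l and quotients of values
  of W appear. And Q need not have boundary values, so F is differentiated off the unit circle only.
  F_z extends continuously across because it is built from L and l alone, F_zbar because its bounded
  factor with Q is multiplied by one that tends to 0.\<close>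

lemma finite_segment_sphere:
  fixes x y :: complex
  assumes "x \<noteq> y"
  shows "finite {t::real. cmod (y + of_real t * (x - y)) = 1}"
proof -
  define p where "p = [:(cmod y)\<^sup>2 - 1, 2 * Re (y * cnj (x - y)), (cmod (x - y))\<^sup>2:]"
  have "p \<noteq> 0" using assms by (simp add: p_def)
  have "poly p t = 0" if t: "cmod (y + of_real t * (x - y)) = 1" for t
  proof -
    have "(cmod (y + of_real t * v))\<^sup>2 = (cmod y)\<^sup>2 + t * (2 * Re (y * cnj v) + t * (cmod v)\<^sup>2)" for v
      by (simp only: cmod_power2) (simp add: algebra_simps power2_eq_square)
    from this[of "x - y"] show ?thesis using t by (simp add: p_def)
  qed
  then have "{t. cmod (y + of_real t * (x - y)) = 1} \<subseteq> {t. poly p t = 0}" by blast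
  then show ?thesis using poly_roots_finite[OF \<open>p \<noteq> 0\<close>] finite_subset by blast
qed

text \<open>A segment meets the circle only finitely often, and the fundamental theorem of calculus
  tolerates finitely many exceptional points if the function is continuous. Local injectivity and
  absolute continuity of the extension both rest on this.\<close>

lemma lipschitz_off_unit_circle:
  assumes S: "convex S" and g: "continuous_on S g"
    and D: "\<And>z. z \<in> S \<Longrightarrow> cmod z \<noteq> 1 \<Longrightarrow> (g has_derivative D z) (at z)"
    and B: "\<And>z h. z \<in> S \<Longrightarrow> cmod z \<noteq> 1 \<Longrightarrow> cmod (D z h) \<le> B * cmod h"
    and "0 \<le> B" and x: "x \<in> S" and y: "y \<in> S"
  shows "cmod (g x - g y) \<le> B * cmod (x - y)"
proof (cases "x = y")
  case False
  define c where "c t = y + of_real t * (x - y)" for t :: real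
  define K where "K = {t. cmod (c t) = 1}"
  have K: "finite K" unfolding K_def c_def by (rule finite_segment_sphere[OF False])
  have cS: "c t \<in> S" if "t \<in> {0..1}" for t
  proof -
    have "c t = (1 - t) *\<^sub>R y + t *\<^sub>R x"
      by (simp add: c_def scaleR_conv_of_real algebra_simps)
    then show ?thesis using that x y S by (auto simp: convex_def)
  qed
  have dc: "(c has_vector_derivative (x - y)) (at t)" for t
    unfolding c_def by (auto intro!: derivative_eq_intros simp: has_vector_derivative_def scaleR_conv_of_real)
  have cc: "continuous_on {0..1} c" unfolding c_def by (intro continuous_intros)
  \<comment> \<open>The value 0 at the crossing times is a default on a finite set, which the
    integral does not see.\<close>
  define d where "d t = (if t \<in> K then 0 else D (c t) (x - y))" for t
  have "(d has_integral (g (c 1) - g (c 0))) {0..1}"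
    unfolding d_def
  proof (rule fundamental_theorem_of_calculus_interior_strong[OF K, where f = "\<lambda>t. g (c t)"])
    show "continuous_on {0..1} (\<lambda>t. g (c t))"
      by (rule continuous_on_compose2[OF g cc]) (use cS in auto)
    fix t assume t: "t \<in> {0<..<1} - K"
    then have "(g has_derivative D (c t)) (at (c t))"
      using D[of "c t"] cS[of t] by (auto simp: K_def)
    from vector_derivative_diff_chain_within[OF dc has_derivative_at_withinI[OF this]]
    show "((\<lambda>t. g (c t)) has_vector_derivative (if t \<in> K then 0 else D (c t) (x - y))) (at t)"
      using t by (simp add: o_def)
  qed simp
  moreover have "norm (d t) \<le> B * cmod (x - y)" if "t \<in> cbox 0 1" for t
    using B[of "c t" "x - y"] cS[of t] that \<open>0 \<le> B\<close> by (auto simp: d_def K_def)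
  ultimately have "norm (g (c 1) - g (c 0)) \<le> B * cmod (x - y) * measure lborel (cbox 0 (1::real))"
    using \<open>0 \<le> B\<close> has_integral_bound[of "B * cmod (x - y)" d "g (c 1) - g (c 0)" 0 1] by auto
  then show ?thesis by (simp add: c_def)
qed auto

lemma abs_continuous_on_lipschitz:
  assumes "0 \<le> B" and lip: "\<And>x y. x \<in> {a..b} \<Longrightarrow> y \<in> {a..b} \<Longrightarrow> cmod (\<phi> x - \<phi> y) \<le> B * \<bar>x - y\<bar>"
  shows "abs_continuous_on a b \<phi>"
  unfolding abs_continuous_on_def
proof (intro allI impI)
  fix e :: real assume e: "e > 0"
  show "\<exists>d>0. \<forall>(n::nat) l u. (\<forall>i<n. a \<le> l i \<and> l i \<le> u i \<and> u i \<le> b) \<and>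
        (\<forall>i<n. \<forall>j<n. i \<noteq> j \<longrightarrow> u i \<le> l j \<or> u j \<le> l i) \<and> (\<Sum>i<n. u i - l i) < d
        \<longrightarrow> (\<Sum>i<n. cmod (\<phi> (u i) - \<phi> (l i))) < e"
  \<comment> \<open>The added 1 covers B = 0.\<close>
  proof (intro exI[of _ "e / (B + 1)"] conjI allI impI, goal_cases)
    case 1 show ?case using e assms by simp
  next
    case (2 n l u)
    have "(\<Sum>i<n. cmod (\<phi> (u i) - \<phi> (l i))) \<le> (\<Sum>i<n. B * (u i - l i))"
    proof (rule sum_mono)
      fix i assume "i \<in> {..<n}"
      then have "a \<le> l i" "l i \<le> u i" "u i \<le> b" using 2 by auto
      then show "cmod (\<phi> (u i) - \<phi> (l i)) \<le> B * (u i - l i)"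
        using lip[of "u i" "l i"] by auto
    qed
    also have "\<dots> = B * (\<Sum>i<n. u i - l i)" by (simp add: sum_distrib_left)
    also have "\<dots> \<le> (B + 1) * (\<Sum>i<n. u i - l i)"
      using 2 by (intro mult_right_mono sum_nonneg) auto
    also have "\<dots> < e" using 2 assms by (simp add: field_simps)
    finally show ?case .
  qed
qed

lemma exp_eq_imp_Ints:
  fixes a b :: complex
  assumes "exp a = exp b"
  shows "(a - b) / (2 * of_real pi * \<i>) \<in> \<int>"
proof -
  obtain n :: int where "a = b + of_real (real_of_int (2 * n) * pi) * \<i>"
    using assms unfolding exp_eq by blast
  then have "(a - b) / (2 * of_real pi * \<i>) = of_int n" by simp
  then show ?thesis by simp
qed

section \<open>Orientation through winding numbers\<close>

text \<open>By injectivity \<open>F (z + r e(t)) - F z\<close> has no zero for r > 0, hence a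
  continuous logarithm on the convex set of all (z, r, t). Its increment from t = 0 to t = 1 is an
  integer multiple of 2 pi i that depends continuously on (z, r), so one circle decides for all; a
  small circle about 0 gives the integer 1.\<close>

lemma sense_preserving_injective:
  assumes F: "continuous_on UNIV F" and inj: "inj F" and D: "(F has_field_derivative 1) (at 0)"
  shows "sense_preserving F"
proof -
  define e where "e t = exp (2 * of_real pi * \<i> * of_real t)" for t :: real
  define S where "S = (UNIV :: complex set) \<times> ({0<..} :: real set) \<times> (UNIV :: real set)"
  define K where "K = (\<lambda>(z, r, t). F (z + of_real r * e t) - F z)"
  have "continuous_on S K"
    unfolding K_def S_def e_def case_prod_beta
    by (intro continuous_intros continuous_on_compose2[OF F]) auto
  moreover have "contractible S"
    unfolding S_def by (intro convex_imp_contractible convex_Times) auto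
  moreover have "K x \<noteq> 0" if "x \<in> S" for x
    using that inj by (auto simp: K_def S_def e_def inj_eq)
  ultimately obtain L where L: "continuous_on S L" and KL: "\<And>x. x \<in> S \<Longrightarrow> K x = exp (L x)"
    using continuous_logarithm_on_contractible by blast
  define N where "N = (\<lambda>(z::complex, r::real). (L (z, r, 1) - L (z, r, 0)) / (2 * of_real pi * \<i>))"
  define T where "T = (UNIV :: complex set) \<times> ({0<..} :: real set)"
  have Nint: "N x \<in> \<int>" if x: "x \<in> T" for x
  proof -
    obtain z r where [simp]: "x = (z, r)" by force
    have "e 1 = e 0" by (simp add: e_def)
    then have "exp (L (z, r, 1)) = exp (L (z, r, 0))"
      using KL[of "(z, r, 1)"] KL[of "(z, r, 0)"] x by (simp add: K_def S_def T_def)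
    from exp_eq_imp_Ints[OF this] show ?thesis by (simp add: N_def)
  qed
  have "N constant_on T"
  proof (rule continuous_discrete_range_constant)
    show "connected T" unfolding T_def by (intro convex_connected convex_Times) auto
    show "continuous_on T N"
      unfolding T_def N_def case_prod_beta
      by (intro continuous_intros continuous_on_compose2[OF L]) (auto simp: S_def)
    fix x assume x: "x \<in> T"
    show "\<exists>e>0. \<forall>y. y \<in> T \<and> N y \<noteq> N x \<longrightarrow> e \<le> norm (N y - N x)"
    proof (intro exI[of _ 1] conjI allI impI)
      fix y assume y: "y \<in> T \<and> N y \<noteq> N x"
      then obtain n where n: "N y - N x = of_int n"
        using Nint[OF x] Nint[of y] by (metis Ints_cases Ints_diff)
      with y have "n \<noteq> 0" by auto
      then show "1 \<le> norm (N y - N x)" unfolding n by simp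
    qed simp
  qed
  then obtain M where M: "\<And>x. x \<in> T \<Longrightarrow> N x = M" by (auto simp: constant_on_def)
  have "M = 1"
  proof -
    have "((\<lambda>h. (F h - F 0) / h) \<longlongrightarrow> 1) (at 0)"
      using D by (simp add: has_field_derivative_iff)
    then have "\<forall>\<^sub>F h in at 0. dist ((F h - F 0) / h) 1 < 1" by (rule tendstoD) simp
    then obtain d where d: "d > 0" "\<And>h. h \<noteq> 0 \<Longrightarrow> cmod h < d \<Longrightarrow> cmod ((F h - F 0) / h - 1) < 1"
      by (auto simp: eventually_at dist_norm)
    define r where "r = d / 2"
    have r: "r > 0" "r < d" using d by (auto simp: r_def)
    define q where "q t = (F (of_real r * e t) - F 0) / (of_real r * e t)" for t
    have ne: "of_real r * e t \<noteq> 0" for t using r by (simp add: e_def)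
    have nm: "cmod (of_real r * e t) = r" for t using r by (simp add: e_def norm_mult)
    have q: "cmod (q t - 1) < 1" for t
      unfolding q_def using d(2)[OF ne, of t] r by (simp only: nm)
    have Req: "Re (q t) > 0" for t
      using q[of t] abs_Re_le_cmod[of "q t - 1"] by auto
    have cq: "continuous_on UNIV q"
      unfolding q_def e_def by (intro continuous_intros continuous_on_compose2[OF F]) (use r in auto)
    \<comment> \<open>\<open>R\<close> compares \<open>L\<close> with the explicit logarithm of
      \<open>r e(t) q(t)\<close>. As \<open>q\<close> stays within distance 1 of 1, its principal
      logarithm is continuous, so \<open>R\<close> is continuous and integer-valued, and the whole
      increment comes from \<open>e\<close>.\<close>
    define R where "R t = (L (0, r, t) - 2 * of_real pi * \<i> * of_real t - of_real (ln r) - Ln (q t)) / (2 * of_real pi * \<i>)" for t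
    have Rint: "R t \<in> \<int>" for t
    proof -
      have "exp (L (0, r, t)) = F (of_real r * e t) - F 0"
        using KL[of "(0, r, t)"] r by (simp add: K_def S_def)
      also have "\<dots> = of_real r * e t * q t" using ne[of t] by (simp add: q_def)
      also have "\<dots> = exp (2 * of_real pi * \<i> * of_real t + of_real (ln r) + Ln (q t))"
      proof -
        have "q t \<noteq> 0" using Req[of t] by auto
        then show ?thesis using r exp_of_real[of "ln r", where ?'a = complex] by (simp add: exp_add e_def)
      qed
      finally show ?thesis using exp_eq_imp_Ints by (simp add: R_def diff_diff_eq)
    qed
    have "R constant_on UNIV"
    proof (rule continuous_discrete_range_constant)
      show "continuous_on UNIV R"
        unfolding R_def
        by (intro continuous_intros continuous_on_compose2[OF L] continuous_on_Ln cq)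
          (use r Req in \<open>auto simp: S_def complex_nonpos_Reals_iff, meson linorder_not_less\<close>)
      fix x
      show "\<exists>e>0. \<forall>y. y \<in> UNIV \<and> R y \<noteq> R x \<longrightarrow> e \<le> norm (R y - R x)"
      proof (intro exI[of _ 1] conjI allI impI)
        fix y assume y: "y \<in> UNIV \<and> R y \<noteq> R x"
        obtain n where n: "R y - R x = of_int n"
          using Rint[of x] Rint[of y] by (metis Ints_cases Ints_diff)
        with y have "n \<noteq> 0" by auto
        then show "1 \<le> norm (R y - R x)" unfolding n by simp
      qed simp
    qed auto
    then have "R 1 = R 0" by (metis constant_on_def UNIV_I)
    moreover have "q 1 = q 0" by (simp add: q_def e_def)
    ultimately have "L (0, r, 1) - L (0, r, 0) = 2 * of_real pi * \<i>"
      by (simp add: R_def field_simps)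
    then have "N (0, r) = 1" by (simp add: N_def)
    then show ?thesis using M[of "(0, r)"] r by (simp add: T_def)
  qed
  show ?thesis
    unfolding sense_preserving_def
  proof (intro allI impI)
    fix z and r :: real assume r: "r > 0"
    have KLz: "F (z + of_real r * e t) - F z = exp (L (z, r, t))" for t
      using KL[of "(z, r, t)"] r by (simp add: K_def S_def)
    show "\<exists>\<theta>::real \<Rightarrow> real. continuous_on {0..1} \<theta> \<and>
           (\<forall>t\<in>{0..1}. F (z + of_real r * exp (2 * of_real pi * \<i> * of_real t)) - F z
               = of_real (cmod (F (z + of_real r * exp (2 * of_real pi * \<i> * of_real t)) - F z))
                 * exp (\<i> * of_real (\<theta> t))) \<and>
           \<theta> 1 - \<theta> 0 = 2 * pi"
      unfolding e_def[symmetric] KLz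
    proof (intro exI[of _ "\<lambda>t. Im (L (z, r, t))"] conjI ballI)
      show "continuous_on {0..1} (\<lambda>t. Im (L (z, r, t)))"
        by (intro continuous_intros continuous_on_compose2[OF L]) (use r in \<open>auto simp: S_def\<close>)
      show "exp (L (z, r, t)) = of_real (cmod (exp (L (z, r, t)))) * exp (\<i> * of_real (Im (L (z, r, t))))" for t
        unfolding norm_exp_eq_Re using exp_eq_polar[of "L (z, r, t)"] unfolding cis_conv_exp .
      have "N (z, r) = 1" using M[of "(z, r)"] r \<open>M = 1\<close> by (simp add: T_def)
      then have "L (z, r, 1) - L (z, r, 0) = 2 * of_real pi * \<i>"
        by (simp add: N_def field_simps)
      then show "Im (L (z, r, 1)) - Im (L (z, r, 0)) = 2 * pi"
        by (metis minus_complex.simps(2) Im_complex_of_real Re_complex_of_real mult.commute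
            Im_i_times mult.assoc of_real_mult of_real_numeral)
    qed
  qed
qed

section \<open>Proper local homeomorphisms with bounded dilatation\<close>

text \<open>\<open>A\<close> and \<open>B\<close> are F_z and F_zbar. On the circle only their
  continuity is assumed, not the derivative of F. \<open>F_eq_0\<close> supplies the one value known
  to have a single preimage, from which injectivity spreads.\<close>

locale C1_off_circle =
  fixes F A B :: "complex \<Rightarrow> complex" and k :: real
  assumes F: "continuous_on UNIV F" and A: "continuous_on UNIV A" and B: "continuous_on UNIV B"
    and k: "0 \<le> k" "k < 1"
    and D: "\<And>z. cmod z \<noteq> 1 \<Longrightarrow> (F has_derivative (\<lambda>h. A z * h + B z * cnj h)) (at z)"
    and A_nonzero: "\<And>z. A z \<noteq> 0" and BA: "\<And>z. cmod (B z) \<le> k * cmod (A z)"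
    and F_eq_0: "\<And>z. F z = 0 \<longleftrightarrow> z = 0" and A0: "A 0 = 1" and B0: "B 0 = 0"
    and proper: "\<And>R. \<exists>S. \<forall>z. cmod (F z) \<le> R \<longrightarrow> cmod z \<le> S"
begin

text \<open>Freezing the coefficients at z0 gives a linear map that expands every vector by at least
  m = (1 - k) |A z0|; near z0 the remainder contracts by m / 2, too little to identify two points.
  Points of the circle are included.\<close>

lemma locally_injective: "\<exists>d>0. inj_on F (ball z0 d)"
proof -
  define m where "m = (1 - k) * cmod (A z0)"
  have m: "m > 0" using k A_nonzero by (simp add: m_def)
  have "continuous (at z0) A" "continuous (at z0) B"
    using A B by (auto simp: continuous_on_eq_continuous_at)
  \<comment> \<open>Each of the two coefficients may vary by m / 4, which adds up to m / 2.\<close>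
  then obtain d1 d2 where d: "d1 > 0" "\<And>z. dist z z0 < d1 \<Longrightarrow> dist (A z) (A z0) < m / 4"
     "d2 > 0" "\<And>z. dist z z0 < d2 \<Longrightarrow> dist (B z) (B z0) < m / 4"
    unfolding continuous_at_eps_delta using m by (metis divide_pos_pos zero_less_numeral)
  define d where "d = min d1 d2"
  define R where "R z = F z - (A z0 * z + B z0 * cnj z)" for z
  have R: "cmod (R x - R y) \<le> (m / 2) * cmod (x - y)" if "x \<in> ball z0 d" "y \<in> ball z0 d" for x y
  proof (rule lipschitz_off_unit_circle[where S = "ball z0 d" and D = "\<lambda>z h. (A z - A z0) * h + (B z - B z0) * cnj h"])
    show "continuous_on (ball z0 d) R"
      unfolding R_def by (intro continuous_intros continuous_on_subset[OF F]) auto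
    fix z assume "z \<in> ball z0 d"
    then have z: "cmod (A z - A z0) \<le> m / 4" "cmod (B z - B z0) \<le> m / 4"
      using d(2)[of z] d(4)[of z] by (auto simp: d_def dist_norm norm_minus_commute)
    show "(R has_derivative (\<lambda>h. (A z - A z0) * h + (B z - B z0) * cnj h)) (at z)" if "cmod z \<noteq> 1"
      unfolding R_def by (auto intro!: derivative_eq_intros D[OF that] simp: algebra_simps)
    fix h
    have "cmod ((A z - A z0) * h + (B z - B z0) * cnj h) \<le> cmod (A z - A z0) * cmod h + cmod (B z - B z0) * cmod h"
      by (rule order.trans[OF norm_triangle_ineq]) (simp add: norm_mult)
    also have "\<dots> \<le> m / 4 * cmod h + m / 4 * cmod h"
      using z by (intro add_mono mult_right_mono) auto
    finally show "cmod ((A z - A z0) * h + (B z - B z0) * cnj h) \<le> (m / 2) * cmod h" by simp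
  qed (use that m in auto)
  have "inj_on F (ball z0 d)"
  proof (rule inj_onI)
    fix x y assume xy: "x \<in> ball z0 d" "y \<in> ball z0 d" "F x = F y"
    have "m * cmod (x - y) = cmod (A z0 * (x - y)) - k * cmod (A z0) * cmod (x - y)"
      by (simp add: m_def norm_mult left_diff_distrib)
    also have "\<dots> \<le> cmod (A z0 * (x - y)) - cmod (B z0 * cnj (x - y))"
      using mult_right_mono[OF BA[of z0], of "cmod (x - y)"] by (simp add: norm_mult del: complex_cnj_diff)
    also have "\<dots> \<le> cmod (A z0 * (x - y) + B z0 * cnj (x - y))"
      using norm_diff_ineq[of "A z0 * (x - y)" "B z0 * cnj (x - y)"] by simp
    also have "A z0 * (x - y) + B z0 * cnj (x - y) = - (R x - R y)"
      using xy by (simp add: R_def algebra_simps)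
    also have "cmod (- (R x - R y)) \<le> (m / 2) * cmod (x - y)"
      unfolding norm_minus_cancel by (rule R) (use xy in auto)
    finally have "m * cmod (x - y) \<le> 0" by simp
    then show "x = y" using m by (simp add: mult_le_0_iff)
  qed
  moreover have "d > 0" using d by (simp add: d_def)
  ultimately show ?thesis by blast
qed

text \<open>Properness in sequential form; it makes both the set of doubly covered values and the
  range closed.\<close>

lemma convergent_preimages:
  assumes "(\<lambda>n. F (X n)) \<longlonglongrightarrow> w"
  obtains l r where "strict_mono (r :: nat \<Rightarrow> nat)" "(X \<circ> r) \<longlonglongrightarrow> l" "F l = w"
proof -
  obtain R where "\<And>n. cmod (F (X n)) \<le> R"
    using convergent_imp_bounded[OF assms] by (auto simp: bounded_iff)
  with proper[of R] obtain S where "\<And>n. cmod (X n) \<le> S" by blast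
  then have "bounded (range X)" by (auto simp: bounded_iff)
  then obtain l r where r: "strict_mono (r :: nat \<Rightarrow> nat)" "(X \<circ> r) \<longlonglongrightarrow> l"
    using bounded_imp_convergent_subsequence by blast
  have "(\<lambda>n. F ((X \<circ> r) n)) \<longlonglongrightarrow> F l"
    by (rule continuous_on_tendsto_compose[OF F r(2)]) auto
  moreover have "(\<lambda>n. F ((X \<circ> r) n)) \<longlonglongrightarrow> w"
    using LIMSEQ_subseq_LIMSEQ[OF assms r(1)] by (simp add: o_def)
  ultimately show ?thesis using that r LIMSEQ_unique by blast
qed

text \<open>The set of points with two preimages is open because \<^term>\<open>F\<close> is locally injective, and
  closed because it is moreover proper; it misses 0, so it is empty.\<close>

lemma injective: "inj F"
proof -
  define T where "T = {w. \<exists>x y. x \<noteq> y \<and> F x = w \<and> F y = w}"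
  have "open T"
    unfolding open_subopen[of T]
  proof
    fix w assume "w \<in> T"
    then obtain x y where xy: "x \<noteq> y" "F x = w" "F y = w" by (auto simp: T_def)
    obtain d e where de: "d > 0" "inj_on F (ball x d)" "e > 0" "inj_on F (ball y e)"
      using locally_injective by metis
    define r where "r = dist x y / 2"
    define U where "U = ball x d \<inter> ball x r"
    define V where "V = ball y e \<inter> ball y r"
    have disj: "U \<inter> V = {}"
    proof (rule ccontr)
      assume "U \<inter> V \<noteq> {}"
      then obtain v where "dist x v < r" "dist y v < r" by (auto simp: U_def V_def)
      then show False using dist_triangle2[of x y v] by (simp add: r_def)
    qed
    have "open (F ` U)" "open (F ` V)"
      using de(2,4) unfolding U_def V_def
      by (meson F continuous_on_subset inf_le1 inj_on_subset invariance_of_domain open_Int open_ball subset_UNIV)+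
    then have "open (F ` U \<inter> F ` V)" by blast
    moreover have "x \<in> U" "y \<in> V" using de xy by (auto simp: U_def V_def r_def)
    then have "w \<in> F ` U \<inter> F ` V" using imageI[of x U F] imageI[of y V F] unfolding xy(2,3) by simp
    moreover have "F ` U \<inter> F ` V \<subseteq> T"
    proof
      fix v assume "v \<in> F ` U \<inter> F ` V"
      then obtain a b where "a \<in> U" "b \<in> V" "v = F a" "v = F b" by blast
      moreover from this disj have "a \<noteq> b" by blast
      ultimately show "v \<in> T" unfolding T_def by (intro CollectI exI[of _ a] exI[of _ b]) auto
    qed
    ultimately show "\<exists>S. open S \<and> w \<in> S \<and> S \<subseteq> T" by blast
  qed
  moreover have "closed T"
    unfolding closed_sequential_limits
  proof (intro allI impI, elim conjE)
    fix W w assume "\<forall>n. W n \<in> T" and W: "W \<longlonglongrightarrow> w"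
    then have "\<forall>n. \<exists>p. fst p \<noteq> snd p \<and> F (fst p) = W n \<and> F (snd p) = W n" by (simp add: T_def)
    from choice[OF this] obtain P where
      P: "\<And>n. fst (P n) \<noteq> snd (P n)" "\<And>n. F (fst (P n)) = W n" "\<And>n. F (snd (P n)) = W n" by blast
    define X Y where "X n = fst (P n)" and "Y n = snd (P n)" for n
    have XY: "X n \<noteq> Y n" "F (X n) = W n" "F (Y n) = W n" for n
      using P by (auto simp: X_def Y_def)
    have "(\<lambda>n. F (X n)) \<longlonglongrightarrow> w" using W XY by simp
    then obtain x r where r: "strict_mono (r :: nat \<Rightarrow> nat)" "(X \<circ> r) \<longlonglongrightarrow> x" "F x = w"
      by (rule convergent_preimages)
    have "(\<lambda>n. F ((Y \<circ> r) n)) \<longlonglongrightarrow> w"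
      using LIMSEQ_subseq_LIMSEQ[OF W r(1)] XY by (simp add: o_def)
    then obtain y q where q: "strict_mono (q :: nat \<Rightarrow> nat)" "(Y \<circ> r \<circ> q) \<longlonglongrightarrow> y" "F y = w"
      using convergent_preimages by blast
    have X: "(X \<circ> r \<circ> q) \<longlonglongrightarrow> x" using r(2) q(1) by (rule LIMSEQ_subseq_LIMSEQ)
    \<comment> \<open>If both sequences of preimages had the same limit, local injectivity there
      would force X n = Y n for some n.\<close>
    have "x \<noteq> y"
    proof
      assume "x = y"
      obtain d where d: "d > 0" "inj_on F (ball x d)" using locally_injective by blast
      have "\<forall>\<^sub>F n in sequentially. dist ((X \<circ> r \<circ> q) n) x < d"
        "\<forall>\<^sub>F n in sequentially. dist ((Y \<circ> r \<circ> q) n) x < d"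
        using tendstoD[OF X d(1)] tendstoD[OF q(2) d(1)] \<open>x = y\<close> by simp_all
      then have "\<forall>\<^sub>F n in sequentially. dist ((X \<circ> r \<circ> q) n) x < d \<and> dist ((Y \<circ> r \<circ> q) n) x < d"
        by (rule eventually_conj)
      from eventually_happens'[OF sequentially_bot this]
      obtain n where "dist ((X \<circ> r \<circ> q) n) x < d" "dist ((Y \<circ> r \<circ> q) n) x < d"
        by blast
      then have "X (r (q n)) = Y (r (q n))"
        using XY(2,3) by - (rule inj_onD[OF d(2)], auto simp: dist_commute)
      then show False using XY(1) by blast
    qed
    then show "w \<in> T" using r(3) q(3) unfolding T_def by (intro CollectI exI[of _ x] exI[of _ y]) simp
  qed
  moreover have "0 \<notin> T" using F_eq_0 by (auto simp: T_def)
  ultimately have "T = {}"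
    using clopen[of T] by auto
  show ?thesis
  proof (rule injI, rule ccontr)
    fix x y assume "F x = F y" "x \<noteq> y"
    then have "F x \<in> T" unfolding T_def by (intro CollectI exI[of _ x] exI[of _ y]) simp
    then show False using \<open>T = {}\<close> by simp
  qed
qed

text \<open>The range is open by invariance of domain and closed by properness.\<close>

lemma surjective: "range F = UNIV"
proof -
  have "open (range F)" by (rule invariance_of_domain[OF F _ injective]) simp
  moreover have "closed (range F)"
    unfolding closed_sequential_limits
  proof (intro allI impI, elim conjE)
    fix W w assume "\<forall>n. W n \<in> range F" and W: "W \<longlonglongrightarrow> w"
    then have "\<forall>n. \<exists>x. F x = W n" by (simp add: image_iff eq_commute)
    from choice[OF this] obtain X where "\<And>n. F (X n) = W n" by blast
    with W have "(\<lambda>n. F (X n)) \<longlonglongrightarrow> w" by simp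
    then show "w \<in> range F" by (rule convergent_preimages) auto
  qed
  ultimately show ?thesis using clopen[of "range F"] by auto
qed

lemma locally_lipschitz:
  obtains C where "C \<ge> 0" "\<And>x y. x \<in> cball 0 R \<Longrightarrow> y \<in> cball 0 R \<Longrightarrow> cmod (F x - F y) \<le> C * cmod (x - y)"
proof -
  have "compact (A ` cball 0 R)" "compact (B ` cball 0 R)"
    by (auto intro!: compact_continuous_image continuous_on_subset[OF A] continuous_on_subset[OF B])
  from this[THEN compact_imp_bounded] obtain a b where "a > 0" "b > 0"
      and "\<forall>x\<in>A ` cball 0 R. cmod x \<le> a" "\<forall>x\<in>B ` cball 0 R. cmod x \<le> b"
    unfolding bounded_pos by blast
  then have ab: "a > 0" "b > 0" "\<And>z. z \<in> cball 0 R \<Longrightarrow> cmod (A z) \<le> a" "\<And>z. z \<in> cball 0 R \<Longrightarrow> cmod (B z) \<le> b"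
    by blast+
  show thesis
  proof (rule that[of "a + b"])
    fix x y :: complex assume xy: "x \<in> cball 0 R" "y \<in> cball 0 R"
    show "cmod (F x - F y) \<le> (a + b) * cmod (x - y)"
    proof (rule lipschitz_off_unit_circle[where S = "cball 0 R" and D = "\<lambda>z h. A z * h + B z * cnj h"])
      show "continuous_on (cball 0 R) F" by (rule continuous_on_subset[OF F]) simp
      fix z h assume z: "z \<in> cball (0::complex) R"
      have "cmod (A z * h + B z * cnj h) \<le> cmod (A z) * cmod h + cmod (B z) * cmod h"
        by (rule order.trans[OF norm_triangle_ineq]) (simp add: norm_mult)
      also have "\<dots> \<le> a * cmod h + b * cmod h"
        using ab z by (intro add_mono mult_right_mono) auto
      finally show "cmod (A z * h + B z * cnj h) \<le> (a + b) * cmod h" by (simp add: algebra_simps)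
    qed (use D ab xy in auto)
  qed (use ab in auto)
qed

lemma ACL: "ACL F"
proof -
  \<comment> \<open>An isometric parametrisation p covers horizontal and vertical lines at once;
    over [a, b] it stays in a disc on which F is Lipschitz.\<close>
  have *: "abs_continuous_on a b (\<lambda>t. F (p t))"
    if p: "\<And>s t. cmod (p s - p t) = \<bar>s - t\<bar>" for p a b
  proof -
    obtain C where C: "C \<ge> 0" "\<And>x y. x \<in> cball 0 (cmod (p a) + \<bar>b - a\<bar>) \<Longrightarrow> y \<in> cball 0 (cmod (p a) + \<bar>b - a\<bar>)
          \<Longrightarrow> cmod (F x - F y) \<le> C * cmod (x - y)"
      using locally_lipschitz by blast
    have "p t \<in> cball 0 (cmod (p a) + \<bar>b - a\<bar>)" if "t \<in> {a..b}" for t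
      using that p[of t a] norm_triangle_sub[of "p t" "p a"] by auto
    then show ?thesis
      using C p by (intro abs_continuous_on_lipschitz[of C]) metis+
  qed
  have "cmod (Complex s y - Complex t y) = \<bar>s - t\<bar>" "cmod (Complex x s - Complex x t) = \<bar>s - t\<bar>" for s t x y
    by (simp_all add: cmod_def)
  then show ?thesis unfolding ACL_def by (simp add: *)
qed

theorem qc_automorphism: "qc_automorphism k F"
  unfolding qc_automorphism_def
proof (intro conjI)
  show "\<exists>G. homeomorphism UNIV UNIV F G"
    using invariance_of_domain_homeomorphism[OF open_UNIV F _ injective] surjective
    by (metis order_refl)
  show "sense_preserving F"
    using D[of 0] by (intro sense_preserving_injective F injective)
      (simp add: A0 B0 has_field_derivative_def lambda_one)
  show "ACL F" by (rule ACL)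
  have "sphere 0 1 \<in> null_sets (lebesgue :: complex measure)"
    using negligible_iff_null_sets negligible_sphere by blast
  then have "AE p in lebesgue. p \<notin> sphere (0::complex) 1" by (rule AE_not_in)
  then show "AE p in lebesgue. \<exists>Fx Fy.
        ((\<lambda>t::real. F (p + of_real t)) has_vector_derivative Fx) (at 0) \<and>
        ((\<lambda>t::real. F (p + \<i> * of_real t)) has_vector_derivative Fy) (at 0) \<and>
        cmod ((Fx + \<i> * Fy) / 2) \<le> k * cmod ((Fx - \<i> * Fy) / 2)"
  proof (rule AE_mp, intro AE_I2 impI)
    fix p assume "p \<notin> sphere (0::complex) 1"
    then have Dp: "(F has_derivative (\<lambda>h. A p * h + B p * cnj h)) (at p)" by (intro D) simp
    have *: "((\<lambda>t::real. F (p + v * of_real t)) has_vector_derivative (A p * v + B p * cnj v)) (at 0)" for v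
    proof -
      have "((\<lambda>t::real. p + v * of_real t) has_vector_derivative v) (at 0)"
        by (auto intro!: derivative_eq_intros simp: has_vector_derivative_def scaleR_conv_of_real)
      from vector_derivative_diff_chain_within[OF this, of F "\<lambda>h. A p * h + B p * cnj h"] Dp
      show ?thesis by (simp add: o_def has_derivative_at_withinI)
    qed
    show "\<exists>Fx Fy.
        ((\<lambda>t::real. F (p + of_real t)) has_vector_derivative Fx) (at 0) \<and>
        ((\<lambda>t::real. F (p + \<i> * of_real t)) has_vector_derivative Fy) (at 0) \<and>
        cmod ((Fx + \<i> * Fy) / 2) \<le> k * cmod ((Fx - \<i> * Fy) / 2)"
    \<comment> \<open>With F_x = A + B and F_y = i (A - B) the two combinations are F_zbar = B and
      F_z = A.\<close>
    proof (intro exI conjI)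
      show "((\<lambda>t::real. F (p + of_real t)) has_vector_derivative (A p + B p)) (at 0)"
        using *[of 1] by simp
      show "((\<lambda>t::real. F (p + \<i> * of_real t)) has_vector_derivative (\<i> * (A p - B p))) (at 0)"
        using *[of \<i>] by (simp add: algebra_simps)
      show "cmod ((A p + B p + \<i> * (\<i> * (A p - B p))) / 2) \<le> k * cmod ((A p + B p - \<i> * (\<i> * (A p - B p))) / 2)"
        using BA[of p] by (simp flip: mult.assoc)
    qed
  qed
qed (use k in auto)

end

subsection \<open>Starlike functions and Bazilevi\v{c} data\<close>

text \<open>The Noshiro-Warschawski argument: the mean value theorem for real parts, applied to G /
  (x - y) on the segment. The sign is kept, since starlikeness needs more than injectivity.\<close>

lemma Re_difference_quotient_pos:
  assumes "convex S" and G: "\<And>u. u \<in> S \<Longrightarrow> (G has_field_derivative G' u) (at u)"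
    and "\<And>u. u \<in> S \<Longrightarrow> Re (G' u) > 0" and "x \<in> S" "y \<in> S" "x \<noteq> y"
  shows "Re ((G x - G y) / (x - y)) > 0"
proof -
  have seg: "closed_segment y x \<subseteq> S" using assms by (simp add: closed_segment_subset)
  have "((\<lambda>u. G u / (x - y)) has_field_derivative G' u / (x - y)) (at u)" if "u \<in> closed_segment y x" for u
    using that seg G by (auto intro: DERIV_cdivide)
  then obtain u where "u \<in> closed_segment y x"
    "Re (G x / (x - y)) - Re (G y / (x - y)) = Re (G' u / (x - y) * (x - y))"
    using complex_mvt_line[of y x "\<lambda>u. G u / (x - y)" "\<lambda>u. G' u / (x - y)"] by blast
  then show ?thesis using assms seg by (auto simp: diff_divide_distrib)
qed

text \<open>In logarithmic coordinates g becomes \<open>G\<close>, with exp (G u) = g (exp u) and Re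
  G' > 0 on the left half-plane. Injectivity of g follows from that of G. If g z1 = t g z2 with 0 <
  t <= 1, then G decreases by a real amount between suitable logarithms, which forces |z1| <= |z2|;
  this traps preimages of a radial segment in a compact disc.\<close>

lemma starlike_univalent_exp:
  assumes H: "H holomorphic_on unit_disc" and H0: "H 0 = 0"
    and pos: "\<And>z. z \<in> unit_disc \<Longrightarrow> Re (1 + z * deriv H z) > 0"
  shows "starlike_univalent (\<lambda>z. z * exp (H z))"
proof -
  define g where "g z = z * exp (H z)" for z
  define G where "G u = u + H (exp u)" for u
  define S where "S = {u. Re u < 0}"
  have S: "convex S" unfolding S_def by (rule convex_halfspace_Re_lt)
  have expS: "exp u \<in> unit_disc" if "u \<in> S" for u using that by (simp add: S_def unit_disc_def)
  have dH: "(H has_field_derivative deriv H z) (at z)" if "z \<in> unit_disc" for z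
    using H that by (intro holomorphic_derivI) (auto simp: unit_disc_def)
  have dG: "(G has_field_derivative 1 + exp u * deriv H (exp u)) (at u)" if "u \<in> S" for u
  proof -
    have "((\<lambda>u. H (exp u)) has_field_derivative deriv H (exp u) * exp u) (at u)"
      by (rule DERIV_chain2[where f = H and g = exp]) (auto intro: dH expS that)
    then show ?thesis unfolding G_def by (auto intro!: derivative_eq_intros)
  qed
  have quot: "Re ((G x - G y) / (x - y)) > 0" if "x \<in> S" "y \<in> S" "x \<noteq> y" for x y
    using Re_difference_quotient_pos[OF S dG pos[OF expS]] that by blast
  have g0: "g z = 0 \<longleftrightarrow> z = 0" for z by (simp add: g_def)
  \<comment> \<open>\<open>G\<close> commutes with translation by 2 pi i, so the ambiguity of the
    logarithm is absorbed into v.\<close>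
  have lift: "\<exists>u v. u \<in> S \<and> v \<in> S \<and> exp u = z1 \<and> exp v = z2 \<and> G u = G v + of_real (ln t)"
    if z: "z1 \<in> unit_disc" "z2 \<in> unit_disc" "z1 \<noteq> 0" "z2 \<noteq> 0" and t: "t > 0" and eq: "g z1 = of_real t * g z2"
    for z1 z2 t
  proof -
    have SLn: "Ln z1 \<in> S" "Ln z2 \<in> S" using z by (auto simp: S_def unit_disc_def)
    have "exp (G (Ln z1)) = exp (G (Ln z2) + of_real (ln t))"
      using z t eq exp_of_real[of "ln t", where ?'a = complex]
      by (simp add: G_def g_def exp_add mult_ac)
    then obtain n :: int where "G (Ln z1) = G (Ln z2) + of_real (ln t) + of_real (real_of_int (2 * n) * pi) * \<i>"
      unfolding exp_eq by blast
    moreover define v where "v = Ln z2 + of_real (real_of_int (2 * n) * pi) * \<i>"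
    moreover have "exp v = z2" using z unfolding v_def
      by (metis exp_eq exp_Ln)
    moreover from this have "G v = G (Ln z2) + of_real (real_of_int (2 * n) * pi) * \<i>"
      using z by (simp add: G_def v_def)
    ultimately have "v \<in> S" "exp v = z2" "G (Ln z1) = G v + of_real (ln t)"
      using SLn by (auto simp: S_def)
    then show ?thesis using SLn z by (metis exp_Ln)
  qed
  have inj: "inj_on g unit_disc"
  proof (rule inj_onI)
    fix z1 z2 assume z: "z1 \<in> unit_disc" "z2 \<in> unit_disc" "g z1 = g z2"
    show "z1 = z2"
    proof (cases "z1 = 0 \<or> z2 = 0")
      case True then show ?thesis using z g0 by metis
    next
      case False
      with lift[of z1 z2 1] z obtain u v where "u \<in> S" "v \<in> S" "exp u = z1" "exp v = z2" "G u = G v" by auto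
      with quot[of u v] show ?thesis by (cases "u = v") auto
    qed
  qed
  have le: "cmod z1 \<le> cmod z2" if z: "z1 \<in> unit_disc" "z2 \<in> unit_disc" and z2: "z2 \<noteq> 0"
    and t: "t \<in> {0..1}" and eq: "g z1 = of_real t * g z2" for z1 z2 t
  proof (cases "z1 = 0")
    case False
    then have "g z1 \<noteq> 0" by (simp add: g0)
    with eq t have "t > 0" by (cases "t = 0") auto
    with lift[of z1 z2 t] z z2 False eq obtain u v where uv: "u \<in> S" "v \<in> S" "exp u = z1" "exp v = z2" "G u = G v + of_real (ln t)"
      by auto
    \<comment> \<open>\<open>G u - G v = ln t\<close> is real and not positive, so a quotient by u -
      v of positive real part makes Re (u - v) negative.\<close>
    have "Re u \<le> Re v"
    proof (cases "u = v")
      case False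
      have "Re (of_real (ln t) / (u - v)) > 0" using quot[of u v] uv False by simp
      then have "ln t * Re (u - v) > 0" by (simp add: Re_divide zero_less_divide_iff not_sum_power2_lt_zero)
      moreover have "ln t \<le> 0" using t \<open>t > 0\<close> by simp
      ultimately show ?thesis by (auto simp: zero_less_mult_iff)
    qed simp
    then show ?thesis using uv by (metis norm_exp_eq_Re exp_le_cancel_iff)
  qed simp
  have gh: "g holomorphic_on unit_disc" unfolding g_def by (intro holomorphic_intros H)
  then have gc: "continuous_on unit_disc g" by (rule holomorphic_on_imp_continuous_on)
  have "closed_segment 0 (g z0) \<subseteq> g ` unit_disc" if z0: "z0 \<in> unit_disc" for z0
  proof (cases "z0 = 0")
    case True
    then have "g z0 = 0" by (simp add: g0)
    then show ?thesis using z0 imageI[of z0 unit_disc g] by simp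
  next
    case False
    \<comment> \<open>T is open by invariance of domain. By \<open>le\<close> the image of the disc
      may be replaced by that of a compact disc, so T is also closed, and connectedness makes it all
      of [0, 1].\<close>
    define T where "T = {0..1} \<inter> (\<lambda>t. of_real t * g z0) -` (g ` unit_disc)"
    have cb: "cball 0 (cmod z0) \<subseteq> unit_disc" using z0 by (auto simp: unit_disc_def)
    have T: "T = {0..1} \<inter> (\<lambda>t. of_real t * g z0) -` (g ` cball 0 (cmod z0))"
    proof
      show "T \<subseteq> {0..1} \<inter> (\<lambda>t. of_real t * g z0) -` (g ` cball 0 (cmod z0))"
      proof
        fix t assume t: "t \<in> T"
        then obtain z where z: "z \<in> unit_disc" "of_real t * g z0 = g z" by (auto simp: T_def)
        then have "cmod z \<le> cmod z0" using le[of z z0 t] z0 False t by (auto simp: T_def)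
        then show "t \<in> {0..1} \<inter> (\<lambda>t. of_real t * g z0) -` (g ` cball 0 (cmod z0))"
          using z t by (auto simp: T_def)
      qed
    qed (use cb in \<open>auto simp: T_def\<close>)
    have "open (g ` unit_disc)"
      by (rule invariance_of_domain[OF gc _ inj]) (simp add: unit_disc_def)
    then have "openin (top_of_set {0..1}) T"
      unfolding T_def by (intro continuous_openin_preimage_gen continuous_intros)
    moreover have "compact (g ` cball 0 (cmod z0))"
      by (intro compact_continuous_image continuous_on_subset[OF gc] cb) simp
    then have "closedin (top_of_set {0..1}) T"
      unfolding T by (intro continuous_closedin_preimage continuous_intros compact_imp_closed)
    moreover have "1 \<in> T" using z0 by (auto simp: T_def)
    ultimately have T01: "T = {0..1}"
      using connected_clopen[of "{0..1::real}"] by (auto simp: connected_Icc)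
    show ?thesis
    proof
      fix w assume "w \<in> closed_segment 0 (g z0)"
      then obtain t where t: "t \<in> {0..1}" "w = of_real t * g z0"
        by (auto simp: in_segment scaleR_conv_of_real)
      then have "t \<in> T" by (simp add: T01)
      then show "w \<in> g ` unit_disc" by (simp add: T_def t)
    qed
  qed
  moreover have "class_A g"
  proof -
    have "(g has_field_derivative 1) (at 0)"
      unfolding g_def
      by (auto intro!: derivative_eq_intros dH simp: unit_disc_def H0)
    then show ?thesis using gh g0 by (auto simp: class_A_def DERIV_imp_deriv)
  qed
  ultimately show ?thesis using inj
    unfolding starlike_univalent_def g_def by auto
qed

text \<open>The bound on z h' degenerates at 0, so h' is bounded by compactness on |z| <= 1/2;
  elsewhere dividing by |z| costs a factor 2.\<close>

lemma lipschitz_of_bounded_log_derivative: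
  assumes h: "h holomorphic_on ball 0 1" and C: "\<And>z. z \<in> ball 0 1 \<Longrightarrow> cmod (z * deriv h z) \<le> C"
  obtains B where "\<And>x y. x \<in> ball 0 1 \<Longrightarrow> y \<in> ball 0 1 \<Longrightarrow> cmod (h x - h y) \<le> B * cmod (x - y)"
proof -
  have "continuous_on (cball 0 (1/2)) (deriv h)"
    by (rule holomorphic_on_imp_continuous_on, rule holomorphic_on_subset[OF holomorphic_deriv[OF h]]) auto
  then have "bounded (deriv h ` cball 0 (1/2))"
    by (intro compact_imp_bounded compact_continuous_image) auto
  then obtain b where b: "\<And>z. z \<in> cball 0 (1/2) \<Longrightarrow> cmod (deriv h z) \<le> b"
    unfolding bounded_iff by blast
  have bd: "cmod (deriv h z) \<le> max b (2 * C)" if "z \<in> ball 0 1" for z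
  proof (cases "z \<in> cball 0 (1/2)")
    case True then show ?thesis using b by (auto intro: max.coboundedI1)
  next
    case False
    then have "(1/2) * cmod (deriv h z) \<le> cmod z * cmod (deriv h z)" by (intro mult_right_mono) auto
    also have "\<dots> \<le> C" using C[OF that] by (simp add: norm_mult)
    finally show ?thesis by simp
  qed
  show thesis
  proof (rule that)
    fix x y :: complex assume "x \<in> ball 0 1" "y \<in> ball 0 1"
    then show "cmod (h x - h y) \<le> max b (2 * C) * cmod (x - y)"
      by (intro field_differentiable_bound[of "ball 0 1" h "deriv h"])
        (auto intro: bd has_field_derivative_at_within holomorphic_derivI[OF h])
  qed
qed

lemma nonneg_on_cball:
  fixes \<phi> :: "complex \<Rightarrow> real"
  assumes c: "continuous_on (cball 0 r) \<phi>" and nn: "\<And>z. z \<in> ball 0 r \<Longrightarrow> \<phi> z \<ge> 0"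
    and r: "r > 0" and z: "z \<in> cball 0 r"
  shows "\<phi> z \<ge> 0"
proof (rule continuous_ge_on_closure[where S = "ball 0 r" and f = \<phi> and x = z and a = 0])
  show "continuous_on (closure (ball 0 r)) \<phi>" using c r by simp
  show "z \<in> closure (ball 0 r)" using z r by simp
qed (use nn in auto)

section \<open>The Riccati equation and regularity up to the circle\<close>

text \<open>The function f enters through the two logarithms only, so no power needs a choice of
  branch. \<open>key\<close> says that they belong to the same f: both sides equal z f' / f.\<close>

locale bazilevich_data =
  fixes \<alpha> \<beta> k :: real and L l :: "complex \<Rightarrow> complex"
  assumes \<alpha>: "\<alpha> > 0" and k: "0 \<le> k" "k < 1"
    and L: "L holomorphic_on ball 0 1" and l: "l holomorphic_on ball 0 1"
    and L0: "L 0 = 0" and l0: "l 0 = 0"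
    and key: "\<And>z. z \<in> ball 0 1 \<Longrightarrow> exp (l z - Complex \<alpha> \<beta> * L z) = 1 + z * deriv L z"
    and bound: "\<And>z. z \<in> ball 0 1 \<Longrightarrow>
      cmod (Complex \<alpha> \<beta> + z * deriv l z - of_real ((\<alpha>\<^sup>2 + \<beta>\<^sup>2) / \<alpha>)) \<le> k * ((\<alpha>\<^sup>2 + \<beta>\<^sup>2) / \<alpha>)"
begin

definition s :: complex where "s = Complex \<alpha> \<beta>"
definition c :: real where "c = (\<alpha>\<^sup>2 + \<beta>\<^sup>2) / \<alpha>"
text \<open>On the disc this is s z f' / f. The exponential form has no zeros and still makes sense
  on the closed disc once L and l are extended there, without their derivatives.\<close>

definition p :: "complex \<Rightarrow> complex" where "p z = s * exp (l z - s * L z)"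
definition Q :: "complex \<Rightarrow> complex" where "Q z = s + z * deriv l z"

lemma c_pos: "c > 0"
  using \<alpha> by (simp add: c_def add_pos_nonneg)

lemma s_nonzero: "s \<noteq> 0"
  using \<alpha> by (auto simp: s_def complex_eq_iff)

lemma p_nonzero: "p z \<noteq> 0"
  by (simp add: p_def s_nonzero)

lemma p_eq: "z \<in> ball 0 1 \<Longrightarrow> p z = s + s * (z * deriv L z)"
  using key by (simp add: p_def s_def algebra_simps)

lemma Q_bound: "z \<in> ball 0 1 \<Longrightarrow> cmod (Q z - of_real c) \<le> k * c"
  using bound by (simp add: Q_def s_def c_def)

lemma Re_Q_pos: "z \<in> ball 0 1 \<Longrightarrow> Re (Q z) > 0"
proof -
  assume "z \<in> ball 0 1"
  then have "\<bar>Re (Q z - of_real c)\<bar> \<le> k * c" using Q_bound abs_Re_le_cmod order_trans by blast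
  moreover have "k * c < 1 * c" using k c_pos by (intro mult_strict_right_mono) auto
  ultimately show ?thesis by simp
qed

lemma dL: "z \<in> ball 0 1 \<Longrightarrow> (L has_field_derivative deriv L z) (at z)"
  and dl: "z \<in> ball 0 1 \<Longrightarrow> (l has_field_derivative deriv l z) (at z)"
  using L l by (auto intro!: holomorphic_derivI)

lemma dp: "z \<in> ball 0 1 \<Longrightarrow> (p has_field_derivative p z * (deriv l z - s * deriv L z)) (at z)"
  unfolding p_def by (auto intro!: derivative_eq_intros dL dl)

lemma z_dp: "z \<in> ball 0 1 \<Longrightarrow> z * (p z * (deriv l z - s * deriv L z)) = p z * (Q z - p z)"
  using p_eq[of z] by (simp add: Q_def algebra_simps)

lemma p_cont: "continuous_on (ball 0 1) p"
  unfolding p_def using L l by (intro continuous_intros holomorphic_on_imp_continuous_on)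

text \<open>At a point of least modulus with \<^term>\<open>Re (p z) \<le> 0\<close>, the tangential derivative of
  \<^term>\<open>Re (p z)\<close> vanishes; the Riccati equation \<^term>\<open>z * deriv p z = p z * (Q z - p z)\<close>
  then forces \<^term>\<open>p z = 0\<close>.\<close>

lemma Re_p_pos:
  assumes "z \<in> ball 0 1" shows "Re (p z) > 0"
proof (rule ccontr)
  assume neg: "\<not> Re (p z) > 0"
  define K where "K = cball 0 (cmod z) \<inter> {w. Re (p w) \<le> 0}"
  have sub: "cball 0 (cmod z) \<subseteq> ball (0::complex) 1" using assms by auto
  have "closed {w \<in> cball 0 (cmod z). Re (p w) \<le> 0}"
    using continuous_on_subset[OF p_cont sub]
    by (intro continuous_closed_preimage_constant continuous_on_closed_Collect_le continuous_intros closed_Collect_le) auto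
  moreover have "{w \<in> cball 0 (cmod z). Re (p w) \<le> 0} = K" by (auto simp: K_def)
  ultimately have "compact K" by (metis K_def compact_Int_closed compact_cball inf.idem inf.left_idem inf_commute)
  moreover have "z \<in> K" using neg by (simp add: K_def)
  ultimately obtain w where w: "w \<in> K" "\<And>v. v \<in> K \<Longrightarrow> cmod w \<le> cmod v"
    using continuous_attains_inf[of K cmod] by (auto intro: continuous_intros)
  have w1: "w \<in> ball 0 1" and wz: "cmod w \<le> cmod z" and Rw: "Re (p w) \<le> 0" using w(1) assms by (auto simp: K_def)
  have "w \<noteq> 0"
  proof
    assume "w = 0"
    then have "Re (p w) = \<alpha>" by (simp add: p_def L0 l0) (simp add: s_def)
    with Rw \<alpha> show False by simp
  qed
  have pos: "Re (p v) \<ge> 0" if "v \<in> ball 0 (cmod w)" for v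
  proof (rule ccontr)
    assume "\<not> Re (p v) \<ge> 0"
    then have "v \<in> K" using that wz by (simp add: K_def)
    then show False using w(2)[of v] that by simp
  qed
  have nn: "Re (p v) \<ge> 0" if "v \<in> cball 0 (cmod w)" for v
  proof (rule nonneg_on_cball[where \<phi> = "\<lambda>v. Re (p v)"])
    have "continuous_on (cball 0 (cmod w)) p" by (rule continuous_on_subset[OF p_cont]) (use w1 in auto)
    then show "continuous_on (cball 0 (cmod w)) (\<lambda>v. Re (p v))" by (rule continuous_on_Re)
  qed (use pos that \<open>w \<noteq> 0\<close> in auto)
  then have Rw0: "Re (p w) = 0" using Rw by force
  define D where "D = p w * (deriv l w - s * deriv L w)"
  define \<phi> where "\<phi> t = Re (p (w * exp (\<i> * of_real t)))" for t :: real
  have "((\<lambda>t::real. w * exp (\<i> * of_real t)) has_vector_derivative (w * \<i>)) (at 0)"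
    by (auto intro!: derivative_eq_intros has_vector_derivative_real_field)
  from field_vector_diff_chain_at[OF this, of p D] dp[OF w1]
  have "((\<lambda>t::real. p (w * exp (\<i> * of_real t))) has_vector_derivative (w * \<i> * D)) (at 0)"
    by (simp add: o_def D_def)
  then have "(\<phi> has_vector_derivative Re (w * \<i> * D)) (at 0)"
    unfolding \<phi>_def by (rule bounded_linear.has_vector_derivative[OF bounded_linear_Re])
  then have D\<phi>: "(\<phi> has_real_derivative Re (w * \<i> * D)) (at 0)"
    by (simp add: has_real_derivative_iff_has_vector_derivative)
  have min: "\<phi> 0 \<le> \<phi> t" for t
    using nn[of "w * exp (\<i> * of_real t)"] Rw0 by (simp add: \<phi>_def norm_mult)
  have "Re (w * \<i> * D) = 0"
    by (rule DERIV_local_min[OF D\<phi> zero_less_one]) (use min in blast)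
  moreover have "w * \<i> * D = \<i> * (p w * (Q w - p w))"
    using z_dp[OF w1] by (simp add: D_def mult_ac)
  \<comment> \<open>For p w = i y the real part of i p (Q - p) is -y Re Q.\<close>
  ultimately have "Im (p w) * Re (Q w) = 0" using Rw0 by simp
  then have "p w = 0" using Re_Q_pos[OF w1] Rw0 by (simp add: complex_eq_iff)
  then show False using p_nonzero by blast
qed

lemma l_lipschitz:
  obtains B where "\<And>x y. x \<in> ball 0 1 \<Longrightarrow> y \<in> ball 0 1 \<Longrightarrow> cmod (l x - l y) \<le> B * cmod (x - y)"
proof (rule lipschitz_of_bounded_log_derivative[OF l])
  fix z :: complex assume "z \<in> ball 0 1"
  have "cmod (z * deriv l z) \<le> cmod (Q z - of_real c) + cmod (of_real c - s)"
    using norm_triangle_ineq[of "Q z - of_real c" "of_real c - s"] by (simp add: Q_def)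
  also have "\<dots> \<le> k * c + cmod (of_real c - s)"
    using Q_bound[OF \<open>z \<in> ball 0 1\<close>] by simp
  finally show "cmod (z * deriv l z) \<le> k * c + cmod (of_real c - s)" .
qed (rule that)

text \<open>Up to a constant, Re (s L) + alpha ln t is log |f^s| along a ray, and its derivative Re
  p / t is positive. So a lower bound on the disc of radius 1/2 carries over to the whole
  disc.\<close>

lemma Re_sL_half:
  assumes z: "z \<in> ball 0 1"
  shows "Re (s * L (z / 2)) - \<alpha> * ln 2 \<le> Re (s * L z)"
proof -
  define \<phi> where "\<phi> t = Re (s * L (of_real t * z)) + \<alpha> * ln t" for t
  have "\<phi> (1/2) \<le> \<phi> 1"
  proof (rule DERIV_nonneg_imp_nondecreasing[where f = \<phi> and a = "1/2" and b = 1])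
    fix t :: real assume t: "1/2 \<le> t" "t \<le> 1"
    have "cmod (of_real t * z) \<le> 1 * cmod z" using t by (simp add: norm_mult mult_right_le_one_le mult_left_le_one_le)
    then have tz: "of_real t * z \<in> ball 0 1" using z by simp
    have "((\<lambda>t::real. of_real t * z) has_vector_derivative z) (at t)"
      by (auto intro!: derivative_eq_intros simp: has_vector_derivative_def scaleR_conv_of_real)
    from field_vector_diff_chain_at[OF this, of "\<lambda>v. s * L v" "s * deriv L (of_real t * z)"] dL[OF tz]
    have "((\<lambda>t::real. s * L (of_real t * z)) has_vector_derivative (z * (s * deriv L (of_real t * z)))) (at t)"
      by (simp add: o_def DERIV_cmult)
    from bounded_linear.has_vector_derivative[OF bounded_linear_Re this]
    have "((\<lambda>t. Re (s * L (of_real t * z))) has_real_derivative Re (z * (s * deriv L (of_real t * z)))) (at t)"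
      by (simp add: has_real_derivative_iff_has_vector_derivative)
    moreover have "((\<lambda>t. \<alpha> * ln t) has_real_derivative \<alpha> / t) (at t)"
      using t by (auto intro!: derivative_eq_intros)
    ultimately have "(\<phi> has_real_derivative Re (z * (s * deriv L (of_real t * z))) + \<alpha> / t) (at t)"
      unfolding \<phi>_def by (rule DERIV_add)
    moreover have "Re (z * (s * deriv L (of_real t * z))) + \<alpha> / t = Re (p (of_real t * z)) / t"
    proof -
      have "p (of_real t * z) = s + of_real t * (z * (s * deriv L (of_real t * z)))"
        using p_eq[OF tz] by (simp add: mult_ac)
      then have "Re (p (of_real t * z)) = \<alpha> + t * Re (z * (s * deriv L (of_real t * z)))"
        by (simp add: s_def)
      then show ?thesis using t by (simp add: field_simps)
    qed
    moreover have "Re (p (of_real t * z)) / t \<ge> 0" using Re_p_pos[OF tz] t by simp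
    ultimately show "\<exists>y. (\<phi> has_real_derivative y) (at t) \<and> 0 \<le> y" by metis
  qed simp
  then show ?thesis by (simp add: \<phi>_def ln_div)
qed

text \<open>As l is bounded, |p| could blow up only if Re (s L) tended to minus infinity, which
  \<open>Re_sL_half\<close> excludes. This in turn bounds z L' = p / s - 1.\<close>

lemma p_bounded: obtains P where "\<And>z. z \<in> ball 0 1 \<Longrightarrow> cmod (p z) \<le> P"
proof -
  obtain B where B: "\<And>x y. x \<in> ball 0 1 \<Longrightarrow> y \<in> ball 0 1 \<Longrightarrow> cmod (l x - l y) \<le> B * cmod (x - y)"
    using l_lipschitz by blast
  have "continuous_on (cball 0 (1/2)) (\<lambda>z. s * L z)"
    using holomorphic_on_imp_continuous_on[OF L] 
    by (intro continuous_intros) (auto elim: continuous_on_subset)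
  then have "bounded ((\<lambda>z. s * L z) ` cball 0 (1/2))"
    by (intro compact_imp_bounded compact_continuous_image) auto
  then obtain m where m: "\<And>z. z \<in> cball 0 (1/2) \<Longrightarrow> cmod (s * L z) \<le> m"
    unfolding bounded_iff by blast
  show thesis
  proof (rule that)
    fix z :: complex assume z: "z \<in> ball 0 1"
    have "cmod (l z) \<le> B * cmod z" using B[OF z, of 0] by (simp add: l0)
    also have "\<dots> \<le> \<bar>B\<bar> * 1" using z by (intro mult_mono) auto
    finally have "Re (l z) \<le> \<bar>B\<bar>" using complex_Re_le_cmod[of "l z"] by simp
    moreover have "cmod (s * L (z / 2)) \<le> m" using z by (intro m) simp
    then have "- m \<le> Re (s * L (z / 2))" using abs_Re_le_cmod[of "s * L (z / 2)"] by linarith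
    then have "- m - \<alpha> * ln 2 \<le> Re (s * L z)" using Re_sL_half[OF z] by linarith
    ultimately have "Re (l z - s * L z) \<le> \<bar>B\<bar> + m + \<alpha> * ln 2" by simp
    then show "cmod (p z) \<le> cmod s * exp (\<bar>B\<bar> + m + \<alpha> * ln 2)"
      unfolding p_def norm_mult norm_exp_eq_Re by (intro mult_left_mono) auto
  qed
qed

lemma L_lipschitz:
  obtains B where "\<And>x y. x \<in> ball 0 1 \<Longrightarrow> y \<in> ball 0 1 \<Longrightarrow> cmod (L x - L y) \<le> B * cmod (x - y)"
proof -
  obtain P where P: "\<And>z. z \<in> ball 0 1 \<Longrightarrow> cmod (p z) \<le> P" using p_bounded by blast
  show thesis
  proof (rule lipschitz_of_bounded_log_derivative[OF L])
    fix z :: complex assume z: "z \<in> ball 0 1"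
    have "z * deriv L z = p z / s - 1" using p_eq[OF z] s_nonzero by (simp add: field_simps)
    then have "cmod (z * deriv L z) \<le> cmod (p z) / cmod s + 1"
      using norm_triangle_ineq4[of "p z / s" 1] by (simp add: norm_divide)
    also have "\<dots> \<le> P / cmod s + 1" using P[OF z] by (simp add: divide_right_mono)
    finally show "cmod (z * deriv L z) \<le> P / cmod s + 1" .
  qed (rule that)
qed

lemma continuous_extension:
  assumes "\<And>x y. x \<in> ball 0 1 \<Longrightarrow> y \<in> ball 0 1 \<Longrightarrow> cmod (h x - h y) \<le> B * cmod (x - y)"
  obtains g where "continuous_on (cball 0 1) g" "\<And>x. x \<in> ball 0 1 \<Longrightarrow> g x = h x"
proof -
  have "(max B 0)-lipschitz_on (ball 0 1) h"
  proof (rule lipschitz_onI)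
    fix x y :: complex assume "x \<in> ball 0 1" "y \<in> ball 0 1"
    then have "cmod (h x - h y) \<le> B * cmod (x - y)" by (rule assms)
    also have "\<dots> \<le> max B 0 * cmod (x - y)" by (intro mult_right_mono) auto
    finally show "dist (h x) (h y) \<le> max B 0 * dist x y" by (simp add: dist_norm)
  qed simp
  then have uc: "uniformly_continuous_on (ball 0 1) h" by (rule lipschitz_on_uniformly_continuous)
  show thesis
  proof (rule uniformly_continuous_on_extension_on_closure[OF uc])
    fix g assume g: "uniformly_continuous_on (closure (ball 0 1)) g" "\<And>x. x \<in> ball 0 1 \<Longrightarrow> h x = g x"
    show thesis
    proof (rule that)
      show "continuous_on (cball 0 1) g" using uniformly_continuous_imp_continuous[OF g(1)] by simp
      show "g x = h x" if "x \<in> ball 0 1" for x using g(2)[OF that] by simp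
    qed
  qed
qed

section \<open>The Bazilevic integral representation\<close>

text \<open>The fundamental theorem of calculus on [0, z] for \<open>\<Phi>\<close>, which is f^s /
  s along the segment. The integrand may be singular at t = 0, so differentiability is used in the
  open interval only and continuity at the ends.\<close>

lemma bazilevich:
  assumes f: "class_A f" "\<And>z. z \<in> ball 0 1 \<Longrightarrow> f z = z * exp (L z)"
  shows "bazilevich \<alpha> \<beta> f"
proof -
  define H where "H z = l z / of_real \<alpha>" for z
  have H: "H holomorphic_on unit_disc"
    unfolding H_def unit_disc_def using \<alpha> by (intro holomorphic_intros l) auto
  have star: "starlike_univalent (\<lambda>z. z * exp (H z))"
  proof (rule starlike_univalent_exp[OF H])
    show "H 0 = 0" by (simp add: H_def l0)
    fix z assume "z \<in> unit_disc"
    then have z: "z \<in> ball 0 1" by (simp add: unit_disc_def)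
    have "(H has_field_derivative deriv l z / of_real \<alpha>) (at z)"
      unfolding H_def by (rule DERIV_cdivide[OF dl[OF z]])
    then have "1 + z * deriv H z = (Q z - \<i> * of_real \<beta>) / of_real \<alpha>"
      using \<alpha> by (simp add: DERIV_imp_deriv Q_def s_def Complex_eq field_simps)
    then show "Re (1 + z * deriv H z) > 0"
      using Re_Q_pos[OF z] \<alpha> by simp
  qed
  have int: "((\<lambda>t::real. (exp (of_real \<alpha> * H (of_real t * z)) * (of_real t * z) powr of_real \<alpha>)
               * 1 * (of_real t * z) powr (\<i> * of_real \<beta> - 1) * z)
            has_integral (exp (s * L z) * z powr s / s)) {0..1}" if z: "z \<in> ball 0 1" for z
  proof (cases "z = 0")
    case False
    define \<Phi> where "\<Phi> t = exp (s * L (of_real t * z)) * (of_real t * z) powr s / s" for t :: real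
    have tz: "of_real t * z \<in> ball 0 1" if "t \<in> {0..1}" for t :: real
    proof -
      have "cmod (of_real t * z) \<le> 1 * cmod z"
        unfolding norm_mult by (rule mult_right_mono) (use that in auto)
      then show ?thesis using z by simp
    qed
    \<comment> \<open>Scaling by a positive real number does not change the argument, so principal
      powers factor.\<close>
    have powr_tz: "(of_real t * z) powr v = of_real t powr v * z powr v" if "t > 0" for t :: real and v
      using that False by (simp add: powr_def Ln_times_of_real Ln_of_real distrib_left exp_add)
    have Lc: "continuous_on {0..1} (\<lambda>t::real. L (of_real t * z))"
      by (rule continuous_on_compose2[OF holomorphic_on_imp_continuous_on[OF L]])
        (use tz in \<open>auto intro: continuous_intros\<close>)
    \<comment> \<open>At t = 0 this uses Re s = alpha > 0 and the convention 0 powr s = 0.\<close>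
    have "continuous_on {0..1} (\<lambda>t::real. (of_real t * z) powr s)"
    proof -
      have "continuous_on {0..1} (\<lambda>t::real. of_real t powr s * z powr s)"
        by (intro continuous_intros continuous_on_powr_complex) (use \<alpha> in \<open>auto simp: s_def\<close>)
      moreover have "(of_real t * z) powr s = of_real t powr s * z powr s" if "t \<in> {0..1}" for t :: real
        using that powr_tz[of t s] by (cases "t = 0") auto
      ultimately show ?thesis by (subst continuous_on_cong[OF refl]) auto
    qed
    then have "continuous_on {0..1} \<Phi>"
      unfolding \<Phi>_def by (intro continuous_on_divide continuous_on_mult continuous_on_exp continuous_on_const Lc)
        (use s_nonzero in auto)
    moreover have "(\<Phi> has_vector_derivative
        (exp (of_real \<alpha> * H (of_real t * z)) * (of_real t * z) powr of_real \<alpha>) * 1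
          * (of_real t * z) powr (\<i> * of_real \<beta> - 1) * z) (at t)" if t: "t \<in> {0<..<1}" for t :: real
    proof -
      define v where "v = of_real t * z"
      have v: "v \<in> ball 0 1" "v \<noteq> 0" using tz[of t] t False by (auto simp: v_def)
      have "((\<lambda>t. L (t * z)) has_field_derivative deriv L v * z) (at (of_real t))"
        by (rule DERIV_chain2[where f = L and g = "\<lambda>t. t * z"])
          (use dL[OF v(1)] in \<open>auto intro!: derivative_eq_intros simp: v_def\<close>)
      then have "((\<lambda>t. exp (s * L (t * z)) * (t powr s * z powr s) / s) has_field_derivative
          (exp (s * L v) * (s * (z * deriv L v)) * (of_real t powr s * z powr s) + exp (s * L v) * (s * of_real t powr (s - 1) * z powr s)) / s)
          (at (of_real t))"
        using t s_nonzero unfolding v_def by (auto intro!: derivative_eq_intros simp: mult_ac)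
      from has_vector_derivative_real_field[OF this]
      have "((\<lambda>t::real. exp (s * L (of_real t * z)) * (of_real t powr s * z powr s) / s) has_vector_derivative
          (exp (s * L v) * (s * (z * deriv L v)) * (of_real t powr s * z powr s) + exp (s * L v) * (s * of_real t powr (s - 1) * z powr s)) / s)
          (at t)" .
      moreover have "\<forall>\<^sub>F x in nhds t. x \<in> {0<..<1}"
        using t by (intro eventually_nhds_in_open) auto
      then have "\<forall>\<^sub>F x in nhds t. exp (s * L (of_real x * z)) * (of_real x powr s * z powr s) / s = \<Phi> x"
        by eventually_elim (simp add: \<Phi>_def powr_tz)
      ultimately have "(\<Phi> has_vector_derivative
          (exp (s * L v) * (s * (z * deriv L v)) * (of_real t powr s * z powr s) + exp (s * L v) * (s * of_real t powr (s - 1) * z powr s)) / s)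
          (at t)"
        using t by (subst (asm) has_vector_derivative_cong_ev) (auto dest: eventually_nhds_x_imp_x)
      moreover have "(exp (s * L v) * (s * (z * deriv L v)) * (of_real t powr s * z powr s) + exp (s * L v) * (s * of_real t powr (s - 1) * z powr s)) / s
          = (exp (of_real \<alpha> * H v) * v powr of_real \<alpha>) * 1 * v powr (\<i> * of_real \<beta> - 1) * z"
      proof -
        have "of_real t powr (s - 1) * z powr s = v powr s / of_real t"
          using t powr_tz[of t s] by (simp add: v_def powr_diff)
        then have "(exp (s * L v) * (s * (z * deriv L v)) * (of_real t powr s * z powr s) + exp (s * L v) * (s * of_real t powr (s - 1) * z powr s)) / s
          = exp (s * L v) * v powr s * (1 + v * deriv L v) / of_real t"
          using t powr_tz[of t s] s_nonzero by (simp add: v_def field_simps)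
        \<comment> \<open>\<open>key\<close> trades 1 + v L' for exp (l - s L), which turns exp (s
          L) into exp l = (exp H)^alpha.\<close>
        also have "\<dots> = exp (s * L v) * v powr s * exp (l v - s * L v) / of_real t"
          using key[OF v(1)] by (simp add: s_def)
        also have "\<dots> = exp (l v) * (v powr s / v) * z"
          using t v by (simp add: v_def exp_diff)
        also have "v powr s / v = v powr of_real \<alpha> * v powr (\<i> * of_real \<beta> - 1)"
          using v by (simp add: s_def Complex_eq powr_add powr_diff)
        finally show ?thesis using \<alpha> by (simp add: H_def mult_ac)
      qed
      ultimately show ?thesis by (simp add: v_def)
    qed
    ultimately have "((\<lambda>t::real. (exp (of_real \<alpha> * H (of_real t * z)) * (of_real t * z) powr of_real \<alpha>) * 1
          * (of_real t * z) powr (\<i> * of_real \<beta> - 1) * z) has_integral (\<Phi> 1 - \<Phi> 0)) {0..1}"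
      by (intro fundamental_theorem_of_calculus_interior) auto
    then show ?thesis by (simp add: \<Phi>_def)
  qed simp
  show ?thesis
    unfolding bazilevich_def
  proof (rule conjI[OF f(1)], rule exI[of _ "\<lambda>z. z * exp (H z)"], rule exI[of _ "\<lambda>_. 1"], rule exI[of _ 0],
      rule exI[of _ L], rule exI[of _ H], intro conjI ballI)
    show "starlike_univalent (\<lambda>z. z * exp (H z))" by (rule star)
    show "H holomorphic_on unit_disc" by (rule H)
    show "L holomorphic_on unit_disc" unfolding unit_disc_def by (rule L)
    fix z assume "z \<in> unit_disc"
    then have z: "z \<in> ball 0 1" by (simp add: unit_disc_def)
    show "f z = z * exp (L z)" by (rule f(2)[OF z])
    show "((\<lambda>t::real. (exp (of_real \<alpha> * H (of_real t * z)) * (of_real t * z) powr of_real \<alpha>)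
               * 1 * (of_real t * z) powr (\<i> * of_real \<beta> - 1) * z)
            has_integral (exp (Complex \<alpha> \<beta> * L z) * z powr Complex \<alpha> \<beta> / Complex \<alpha> \<beta>)) {0..1}"
      using int[OF z] unfolding s_def .
  qed (simp_all add: H_def l0 L0)
qed

end

subsection \<open>The extension across the unit circle\<close>

text \<open>The differential of the continued map, with \<open>\<eta>\<close> = dz / z and
  \<open>\<eta>'\<close> its conjugate. The terms in p^2 cancel: the Riccati equation accounts
  exactly for having divided W' by W. The surviving conjugate term carries 1 - Q / c.\<close>

lemma bazilevich_dilatation:
  fixes F p Q c s X E \<eta> \<eta>' :: complex
  assumes "c \<noteq> 0" "s \<noteq> 0" "X \<noteq> 0" and X: "X = 1 + p * (E - 1) / c"
  shows "F * (- \<eta>' - (p / s - 1) * \<eta>' + (- p * (Q - p) * \<eta>' * (E - 1) / c + p * E * (\<eta> + \<eta>')) / X / s)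
    = F * p / (s * X) * (E * \<eta> + (E - 1) * (1 - Q / c) * \<eta>')"
proof -
  have Y: "- p * \<eta>' * X + (- p * (Q - p) * \<eta>' * (E - 1) / c + p * E * (\<eta> + \<eta>')) = p * (E * \<eta> + (E - 1) * (1 - Q / c) * \<eta>')"
    unfolding X using \<open>c \<noteq> 0\<close> by (simp add: field_simps)
  have "- \<eta>' - (p / s - 1) * \<eta>' = - p * \<eta>' * X / (s * X)"
    using assms(2,3) by (simp add: field_simps)
  then have "- \<eta>' - (p / s - 1) * \<eta>' + (- p * (Q - p) * \<eta>' * (E - 1) / c + p * E * (\<eta> + \<eta>')) / X / s
    = (- p * \<eta>' * X + (- p * (Q - p) * \<eta>' * (E - 1) / c + p * E * (\<eta> + \<eta>'))) / (s * X)"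
    by (simp only: add_divide_distrib[of "- p * \<eta>' * X"] divide_divide_eq_left mult.commute[of X s])
  then show ?thesis unfolding Y by simp
qed

lemma has_derivative_inverse_cnj:
  assumes "z \<noteq> 0"
  shows "((\<lambda>z. inverse (cnj z)) has_derivative (\<lambda>h. - (inverse (cnj z) * cnj h * inverse (cnj z)))) (at z)"
  using assms by (auto intro!: derivative_eq_intros)

lemma has_derivative_norm_powr:
  assumes "z \<noteq> 0"
  shows "((\<lambda>z. complex_of_real (cmod z powr (2 * c))) has_derivative
    (\<lambda>h. of_real (cmod z powr (2 * c)) * of_real c * (h / z + cnj (h / z)))) (at z)"
proof -
  have "((\<lambda>x. x powr (2 * c)) has_real_derivative 2 * c * cmod z powr (2 * c - 1)) (at (cmod z))"
    using assms by (auto intro!: derivative_eq_intros)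
  then have "((\<lambda>x. x powr (2 * c)) has_derivative (\<lambda>x. 2 * c * cmod z powr (2 * c - 1) * x)) (at (cmod z))"
    by (rule has_field_derivative_imp_has_derivative)
  from has_derivative_of_real[OF has_derivative_compose[OF has_derivative_norm[OF assms] this], where 'a = complex]
  have "((\<lambda>z. complex_of_real (cmod z powr (2 * c))) has_derivative
    (\<lambda>h. of_real (2 * c * cmod z powr (2 * c - 1) * (sgn z \<bullet> h)))) (at z)" by (simp add: inner_commute)
  moreover have "complex_of_real (2 * c * cmod z powr (2 * c - 1) * (sgn z \<bullet> h))
      = of_real (cmod z powr (2 * c)) * of_real c * (h / z + cnj (h / z))" for h
  proof -
    have "sgn z \<bullet> h = Re (h / z) * cmod z"
    proof -
      have "sgn z \<bullet> h = Re (h * cnj z) / cmod z"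
        using assms by (simp add: sgn_eq inner_complex_def divide_simps algebra_simps)
      also have "Re (h * cnj z) = Re (h / z) * (cmod z)\<^sup>2"
        using assms by (simp add: complex_div_cnj[of h z])
      finally show ?thesis using assms by (simp add: power2_eq_square)
    qed
    moreover have "cmod z powr (2 * c - 1) = cmod z powr (2 * c) / cmod z"
      using assms by (simp add: powr_diff)
    ultimately have "2 * c * cmod z powr (2 * c - 1) * (sgn z \<bullet> h) = cmod z powr (2 * c) * c * (2 * Re (h / z))"
      using assms by simp
    then show ?thesis by (simp only: complex_add_cnj of_real_mult)
  qed
  ultimately show ?thesis by (simp only:)
qed

section \<open>The reflected continuation of f\<close>

locale bazilevich_closed = bazilevich_data +
  assumes L_cont: "continuous_on (cball 0 1) L" and l_cont: "continuous_on (cball 0 1) l"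
begin

text \<open>For $z = e^u$ these are $e^{-\bar u}$, $e^{2c\,\mathrm{Re}\,u}$ and the quotient of the continued
  $W$ at $u$ by $W(-\bar u)$, so that \<open>F_out\<close> is the branch of $W^{1/s}$ at $u$. As $\mathrm{Re}\,p \ge 0$,
  \<open>X\<close> stays in the right half-plane and the principal logarithm applies.\<close>

definition mirror :: "complex \<Rightarrow> complex" where "mirror z = inverse (cnj z)"
definition E :: "complex \<Rightarrow> real" where "E z = cmod z powr (2 * c)"
definition X :: "complex \<Rightarrow> complex" where "X z = 1 + p (mirror z) * (of_real (E z) - 1) / of_real c"
definition F_out :: "complex \<Rightarrow> complex" where
  "F_out z = mirror z * exp (L (mirror z) + Ln (X z) / s)"
definition F :: "complex \<Rightarrow> complex" where
  "F z = (if cmod z \<le> 1 then z * exp (L z) else F_out z)"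
text \<open>F_z outside the disc: the coefficient of dz / z from
  \<open>bazilevich_dilatation\<close>, divided by z.\<close>

definition A_out :: "complex \<Rightarrow> complex" where
  "A_out z = F_out z * p (mirror z) * of_real (E z) / (s * X z * z)"
definition A :: "complex \<Rightarrow> complex" where
  "A z = (if cmod z \<le> 1 then exp (L z) * p z / s else A_out z)"
text \<open>F_zbar; the unimodular z / cnj z converts the dilatation from the variable log z to
  z.\<close>

definition B :: "complex \<Rightarrow> complex" where
  "B z = (if cmod z \<le> 1 then 0
    else A_out z * of_real (1 - 1 / E z) * (1 - Q (mirror z) / of_real c) * (z / cnj z))"

lemma mirror_cball: "cmod z \<ge> 1 \<Longrightarrow> mirror z \<in> cball 0 1"
  and mirror_ball: "cmod z > 1 \<Longrightarrow> mirror z \<in> ball 0 1"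
  and mirror_circle: "cmod z = 1 \<Longrightarrow> mirror z = z"
proof -
  have "cmod (mirror z) = inverse (cmod z)" by (simp add: mirror_def norm_inverse)
  then show "cmod z \<ge> 1 \<Longrightarrow> mirror z \<in> cball 0 1" "cmod z > 1 \<Longrightarrow> mirror z \<in> ball 0 1"
    by (auto simp: inverse_le_1_iff inverse_less_1_iff)
  show "mirror z = z" if "cmod z = 1"
    using that complex_norm_square[of z] by (auto simp: mirror_def mult.commute intro!: inverse_unique)
qed

lemma p_cont_cball: "continuous_on (cball 0 1) p"
  unfolding p_def by (intro continuous_intros L_cont l_cont)

lemma Re_p_nonneg: "z \<in> cball 0 1 \<Longrightarrow> Re (p z) \<ge> 0"
  by (rule nonneg_on_cball[where \<phi> = "\<lambda>z. Re (p z)" and r = 1])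
    (auto intro!: continuous_on_Re p_cont_cball less_imp_le[OF Re_p_pos])

lemma E_ge_1: "cmod z \<ge> 1 \<Longrightarrow> E z \<ge> 1"
  using c_pos by (simp add: E_def ge_one_powr_ge_zero)

lemma X_alt: "X z = 1 + of_real ((E z - 1) / c) * p (mirror z)"
  by (simp add: X_def)

lemma Re_X: "cmod z \<ge> 1 \<Longrightarrow> Re (X z) \<ge> 1"
  using Re_p_nonneg[OF mirror_cball] E_ge_1[of z] c_pos by (simp add: X_alt)

lemma X_nonzero: "cmod z \<ge> 1 \<Longrightarrow> X z \<noteq> 0"
  using Re_X[of z] by auto

lemma F_eq_0: "F z = 0 \<longleftrightarrow> z = 0"
  by (auto simp: F_def F_out_def mirror_def)

lemma A_nonzero: "A z \<noteq> 0"
  using X_nonzero[of z] F_eq_0[of z] E_ge_1[of z] p_nonzero s_nonzero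
  by (auto simp: A_def A_out_def F_def split: if_splits)

text \<open>The factor 1 - 1 / E is kept because it vanishes on the circle; continuity of
  \<open>B\<close> there depends on it.\<close>

lemma B_le: "cmod (B z) \<le> k * cmod (A z) * \<bar>1 - 1 / E z\<bar>"
proof (cases "cmod z \<le> 1")
  case False
  have "cmod (1 - Q (mirror z) / of_real c) = cmod (Q (mirror z) - of_real c) / c"
    using c_pos by (simp add: field_simps norm_divide flip: norm_minus_commute[of "of_real c"])
  also have "\<dots> \<le> k" using Q_bound[OF mirror_ball[of z]] False c_pos by (simp add: field_simps)
  finally have "cmod (1 - Q (mirror z) / of_real c) \<le> k" .
  moreover have "cmod (z / cnj z) = 1" using False by (auto simp: norm_divide)
  ultimately show ?thesis
    using mult_left_mono[of "cmod (1 - Q (mirror z) / of_real c)" k "cmod (A_out z) * \<bar>1 - 1 / E z\<bar>"] False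
    unfolding A_def B_def by (simp only: if_False norm_mult norm_of_real mult_1_right mult_ac) (simp add: mult_ac)
qed (simp add: B_def k)

lemma BA: "cmod (B z) \<le> k * cmod (A z)"
proof (cases "cmod z \<le> 1")
  case False
  then have "\<bar>1 - 1 / E z\<bar> \<le> 1" using E_ge_1[of z] by (simp add: abs_le_iff)
  then have "k * cmod (A z) * \<bar>1 - 1 / E z\<bar> \<le> k * cmod (A z) * 1"
    using k by (intro mult_left_mono) auto
  then show ?thesis using B_le[of z] by linarith
qed (simp add: B_def k)

lemma out_cont:
  shows "continuous_on {z. cmod z \<ge> 1} F_out" and "continuous_on {z. cmod z \<ge> 1} A_out"
proof -
  let ?S = "{z. cmod z \<ge> 1}"
  have mirror: "continuous_on ?S mirror" unfolding mirror_def by (intro continuous_intros) auto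
  have Lr: "continuous_on ?S (\<lambda>z. L (mirror z))"
    by (rule continuous_on_compose2[OF L_cont mirror]) (use mirror_cball in auto)
  have pr: "continuous_on ?S (\<lambda>z. p (mirror z))"
    by (rule continuous_on_compose2[OF p_cont_cball mirror]) (use mirror_cball in auto)
  have E: "continuous_on ?S E" unfolding E_def by (intro continuous_intros) auto
  have X: "continuous_on ?S X" unfolding X_def using c_pos by (intro continuous_intros pr E) auto
  have LnX: "continuous_on ?S (\<lambda>z. Ln (X z))"
  proof (rule continuous_on_Ln'[OF X])
    fix z assume "z \<in> ?S"
    then have "Re (X z) \<ge> 1" using Re_X by simp
    then show "X z \<notin> \<real>\<^sub>\<le>\<^sub>0" by (auto simp: complex_nonpos_Reals_iff)
  qed
  show Fo: "continuous_on ?S F_out"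
    unfolding F_out_def using s_nonzero by (intro continuous_intros mirror Lr LnX) auto
  show "continuous_on ?S A_out"
    unfolding A_out_def using s_nonzero X_nonzero by (intro continuous_intros Fo pr X E) auto
qed

lemma UNIV_split: "UNIV = cball 0 1 \<union> {z. cmod z \<ge> 1}"
  by auto

lemma circle_eqs: "cmod z = 1 \<Longrightarrow> E z = 1" "cmod z = 1 \<Longrightarrow> X z = 1"
  by (simp_all add: E_def X_def)

lemma F_cont: "continuous_on UNIV F"
proof -
  have "continuous_on (cball 0 1 \<union> {z. cmod z \<ge> 1}) (\<lambda>z. if cmod z \<le> 1 then z * exp (L z) else F_out z)"
    by (intro continuous_on_cases out_cont continuous_intros L_cont closed_Collect_le)
      (auto simp: F_out_def mirror_circle circle_eqs)
  then show ?thesis unfolding F_def[abs_def] UNIV_split .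
qed

lemma A_cont: "continuous_on UNIV A"
proof -
  have "continuous_on (cball 0 1 \<union> {z. cmod z \<ge> 1}) (\<lambda>z. if cmod z \<le> 1 then exp (L z) * p z / s else A_out z)"
    by (intro continuous_on_cases out_cont continuous_intros L_cont p_cont_cball closed_Collect_le)
      (auto simp: A_out_def F_out_def mirror_circle circle_eqs s_nonzero)
  then show ?thesis unfolding A_def[abs_def] UNIV_split .
qed

text \<open>On the circle \<open>Q\<close> is out of control, but it enters only through 1 - Q / c,
  which is bounded by k on the open disc. By \<open>B_le\<close> the function is squeezed to 0, its
  value there.\<close>

lemma B_cont: "continuous_on UNIV B"
  unfolding continuous_on_eq_continuous_at[OF open_UNIV]
proof
  fix z :: complex
  consider "cmod z < 1" | "cmod z = 1" | "cmod z > 1" by linarith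
  then show "continuous (at z) B"
  proof cases
    case 1
    have "continuous_on (ball 0 1) B"
      by (rule continuous_on_eq[OF continuous_on_const[of _ 0]]) (simp add: B_def)
    then show ?thesis using 1 by (simp add: continuous_on_eq_continuous_at)
  next
    case 3
    let ?S = "{z::complex. cmod z > 1}"
    have S: "open ?S" by (intro open_Collect_less continuous_intros)
    have mirror: "continuous_on ?S mirror" unfolding mirror_def by (intro continuous_intros) auto
    have "continuous_on (ball 0 1) Q"
      unfolding Q_def by (intro continuous_intros holomorphic_on_imp_continuous_on holomorphic_deriv l) auto
    then have Qr: "continuous_on ?S (\<lambda>z. Q (mirror z))"
      by (rule continuous_on_compose2[OF _ mirror]) (use mirror_ball in auto)
    have Ao: "continuous_on ?S A_out" by (rule continuous_on_subset[OF out_cont(2)]) auto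
    have "continuous_on ?S (\<lambda>z. A_out z * of_real (1 - 1 / E z) * (1 - Q (mirror z) / of_real c) * (z / cnj z))"
      unfolding E_def using c_pos by (intro continuous_intros Ao Qr) auto
    then have "continuous_on ?S B"
      by (rule continuous_on_eq) (simp add: B_def)
    then show ?thesis using 3 S by (simp add: continuous_on_eq_continuous_at)
  next
    case 2
    have "continuous (at z) A" using A_cont by (simp add: continuous_on_eq_continuous_at)
    moreover have "continuous (at z) E" using 2 unfolding E_def by (intro continuous_intros) auto
    ultimately have "continuous (at z) (\<lambda>z. k * cmod (A z) * \<bar>1 - 1 / E z\<bar>)"
      using 2 by (intro continuous_intros) (auto simp: circle_eqs)
    then have "((\<lambda>z. k * cmod (A z) * \<bar>1 - 1 / E z\<bar>) \<longlongrightarrow> 0) (at z)"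
      using 2 by (simp add: continuous_at circle_eqs)
    then have "(B \<longlongrightarrow> 0) (at z)"
      by (rule Lim_null_comparison[rotated]) (simp add: B_le)
    moreover have "B z = 0" using 2 by (simp add: B_def)
    ultimately show ?thesis by (simp add: continuous_at)
  qed
qed

text \<open>The chain rule through the reflection, whose differential is conjugate linear;
  \<open>z_dp\<close> removes the derivative of p in favour of Q, and
  \<open>bazilevich_dilatation\<close> collects the terms.\<close>

lemma F_deriv_out:
  assumes z: "cmod z > 1"
  shows "(F_out has_derivative (\<lambda>h. A z * h + B z * cnj h)) (at z)"
proof -
  define \<zeta> where "\<zeta> = mirror z"
  have z0: "z \<noteq> 0" using z by auto
  then have \<zeta>z: "\<zeta> * cnj z = 1" by (simp add: \<zeta>_def mirror_def)
  have \<zeta>: "\<zeta> \<in> ball 0 1" unfolding \<zeta>_def by (rule mirror_ball[OF z])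
  define D where "D h = - (\<zeta> * cnj h * \<zeta>)" for h
  have D: "(mirror has_derivative D) (at z)"
    using has_derivative_inverse_cnj[OF z0] unfolding mirror_def[abs_def] D_def \<zeta>_def .
  have Lr: "((\<lambda>z. L (mirror z)) has_derivative (\<lambda>h. deriv L \<zeta> * D h)) (at z)"
    using has_derivative_compose[OF D has_field_derivative_imp_has_derivative[OF dL]] \<zeta> unfolding \<zeta>_def by blast
  define p' where "p' = p \<zeta> * (deriv l \<zeta> - s * deriv L \<zeta>)"
  have pr: "((\<lambda>z. p (mirror z)) has_derivative (\<lambda>h. p' * D h)) (at z)"
    using has_derivative_compose[OF D has_field_derivative_imp_has_derivative[OF dp]] \<zeta> unfolding \<zeta>_def p'_def by blast
  define e :: complex where "e = of_real (E z)"
  have dE: "((\<lambda>z. complex_of_real (E z)) has_derivative (\<lambda>h. e * of_real c * (h / z + cnj (h / z)))) (at z)"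
    using has_derivative_norm_powr[OF z0, of c] unfolding E_def e_def .
  define D' where "D' h = (p \<zeta> * (e * of_real c * (h / z + cnj (h / z))) + p' * D h * (e - 1)) / of_real c" for h
  have dX: "(X has_derivative D') (at z)"
    unfolding X_def[abs_def] D'_def
    using has_derivative_add[OF has_derivative_const[of 1] has_derivative_mult_left[OF
        has_derivative_mult[OF pr has_derivative_diff[OF dE has_derivative_const[of 1]]], of "inverse (of_real c)"]]
    by (simp add: \<zeta>_def e_def divide_inverse)
  have Xz: "X z \<notin> \<real>\<^sub>\<le>\<^sub>0" "X z \<noteq> 0"
    using Re_X[of z] z X_nonzero[of z] by (auto simp: complex_nonpos_Reals_iff)
  have dLn: "((\<lambda>z. Ln (X z)) has_derivative (\<lambda>h. inverse (X z) * D' h)) (at z)"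
    using has_derivative_compose[OF dX has_field_derivative_imp_has_derivative[OF has_field_derivative_Ln[OF Xz(1)]]] .
  have "((\<lambda>z. L (mirror z) + Ln (X z) / s) has_derivative (\<lambda>h. deriv L \<zeta> * D h + inverse (X z) * D' h / s)) (at z)"
    using s_nonzero by (auto intro!: derivative_eq_intros Lr dLn)
  from has_derivative_compose[OF this has_field_derivative_imp_has_derivative[OF DERIV_exp]]
  have dexp: "((\<lambda>z. exp (L (mirror z) + Ln (X z) / s)) has_derivative
      (\<lambda>h. exp (L \<zeta> + Ln (X z) / s) * (deriv L \<zeta> * D h + inverse (X z) * D' h / s))) (at z)"
    unfolding \<zeta>_def .
  have "(F_out has_derivative (\<lambda>h. \<zeta> * (exp (L \<zeta> + Ln (X z) / s) * (deriv L \<zeta> * D h + inverse (X z) * D' h / s))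
      + D h * exp (L \<zeta> + Ln (X z) / s))) (at z)"
    using has_derivative_mult[OF D dexp] unfolding F_out_def[abs_def] \<zeta>_def .
  moreover have "\<zeta> * (exp (L \<zeta> + Ln (X z) / s) * (deriv L \<zeta> * D h + inverse (X z) * D' h / s))
      + D h * exp (L \<zeta> + Ln (X z) / s) = A z * h + B z * cnj h" for h
  proof -
    define \<eta> where "\<eta> = h / z"
    define \<eta>' where "\<eta>' = cnj (h / z)"
    have h: "h = \<eta> * z" "cnj h = \<eta>' * cnj z" using z0 by (simp_all add: \<eta>_def \<eta>'_def)
    have Dh: "D h = - (\<zeta> * \<eta>')" using \<zeta>z by (simp add: D_def h(2) mult_ac)
    have "deriv L \<zeta> * D h = - (p \<zeta> / s - 1) * \<eta>'"
      using p_eq[OF \<zeta>] s_nonzero by (simp add: Dh field_simps)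
    moreover have p'D: "p' * D h = - p \<zeta> * (Q \<zeta> - p \<zeta>) * \<eta>'"
      using z_dp[OF \<zeta>] by (simp add: Dh p'_def mult_ac)
    have "D' h = - p \<zeta> * (Q \<zeta> - p \<zeta>) * \<eta>' * (e - 1) / of_real c + p \<zeta> * e * (\<eta> + \<eta>')"
      unfolding D'_def \<eta>'_def[symmetric] unfolding \<eta>_def[symmetric] p'D
      using c_pos by (simp add: add_divide_distrib diff_divide_distrib)
    ultimately have "\<zeta> * (exp (L \<zeta> + Ln (X z) / s) * (deriv L \<zeta> * D h + inverse (X z) * D' h / s))
        + D h * exp (L \<zeta> + Ln (X z) / s)
      = F_out z * (- \<eta>' - (p \<zeta> / s - 1) * \<eta>' + (- p \<zeta> * (Q \<zeta> - p \<zeta>) * \<eta>' * (e - 1) / of_real c + p \<zeta> * e * (\<eta> + \<eta>')) / X z / s)"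
      unfolding F_out_def \<zeta>_def[symmetric] Dh by (simp add: divide_inverse ring_distribs mult_ac)
    also have "\<dots> = F_out z * p \<zeta> / (s * X z) * (e * \<eta> + (e - 1) * (1 - Q \<zeta> / of_real c) * \<eta>')"
      by (rule bazilevich_dilatation) (use c_pos s_nonzero Xz in \<open>auto simp: X_def \<zeta>_def e_def\<close>)
    also have "\<dots> = A z * h + B z * cnj h"
    proof -
      have "e \<noteq> 0" using E_ge_1[of z] z by (auto simp: e_def)
      moreover from this have "complex_of_real (1 - 1 / E z) = (e - 1) / e"
        by (simp add: e_def diff_divide_distrib)
      ultimately have "A_out z * of_real (1 - 1 / E z) = F_out z * p \<zeta> * (e - 1) / (s * X z * z)"
        unfolding A_out_def \<zeta>_def[symmetric] e_def[symmetric] by (simp add: mult.assoc)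
      then have "B z = F_out z * p \<zeta> * (e - 1) / (s * X z * z) * (1 - Q \<zeta> / of_real c) * (z / cnj z)"
        using z by (simp add: B_def \<zeta>_def)
      then have "B z * cnj h = F_out z * p \<zeta> / (s * X z) * ((e - 1) * (1 - Q \<zeta> / of_real c) * \<eta>')"
        using z0 by (simp add: h(2))
      moreover have "A z * h = F_out z * p \<zeta> / (s * X z) * (e * \<eta>)"
        using z z0 by (simp add: A_def A_out_def h(1) \<zeta>_def e_def)
      ultimately show ?thesis by (simp add: distrib_left)
    qed
    finally show ?thesis .
  qed
  ultimately show ?thesis by simp
qed

lemma F_deriv:
  assumes z: "cmod z \<noteq> 1"
  shows "(F has_derivative (\<lambda>h. A z * h + B z * cnj h)) (at z)"
proof (cases "cmod z < 1")
  case True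
  then have zb: "z \<in> ball 0 1" by simp
  have "((\<lambda>z. z * exp (L z)) has_field_derivative exp (L z) * (1 + z * deriv L z)) (at z)"
    by (auto intro!: derivative_eq_intros dL[OF zb] simp: algebra_simps)
  also have "exp (L z) * (1 + z * deriv L z) = A z"
    using True p_eq[OF zb] s_nonzero by (simp add: A_def field_simps)
  finally have "((\<lambda>z. z * exp (L z)) has_derivative (\<lambda>h. A z * h + B z * cnj h)) (at z)"
    using True by (simp add: has_field_derivative_def B_def)
  then show ?thesis
    by (rule has_derivative_transform_within_open[OF _ open_ball zb]) (simp add: F_def)
next
  case False
  have "open {z. cmod z > 1}" by (intro open_Collect_less continuous_intros)
  from has_derivative_transform_within_open[OF F_deriv_out this] show ?thesis
    using z False by (simp add: F_def)
qed

text \<open>For large |z| one has |F z| >= exp b |z|. Indeed |X| is at least a multiple of E =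
  |z|^(2 c), and its power 1 / s has modulus |X|^(1 / c) up to a bounded factor, hence at least a
  multiple of |z|^2; the reflection contributes 1 / |z|.\<close>

lemma F_proper: "\<exists>S. \<forall>z. cmod (F z) \<le> R \<longrightarrow> cmod z \<le> S"
proof -
  have ne: "cball 0 1 \<noteq> ({} :: complex set)" by simp
  have "continuous_on (cball 0 1) (\<lambda>z. cmod (p z))" by (intro continuous_intros p_cont_cball)
  from continuous_attains_inf[OF compact_cball ne this]
  obtain w where w: "\<And>z. z \<in> cball 0 1 \<Longrightarrow> cmod (p w) \<le> cmod (p z)" by blast
  define m where "m = cmod (p w)"
  have m: "m > 0" by (simp add: m_def p_nonzero)
  have "continuous_on (cball 0 1) (\<lambda>z. Re (L z))" by (intro continuous_intros L_cont)
  from continuous_attains_inf[OF compact_cball ne this]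
  obtain v where v: "\<And>z. z \<in> cball 0 1 \<Longrightarrow> Re (L v) \<le> Re (L z)" by blast
  \<comment> \<open>The terms are lower bounds for Re L, for ln |X| / c apart from its growth, and
    for the contribution of the argument of X, which is at most pi.\<close>
  define b where "b = Re (L v) + ln (m / (2 * c)) / c - \<bar>\<beta>\<bar> * pi / (\<alpha>\<^sup>2 + \<beta>\<^sup>2)"
  \<comment> \<open>The first entry gives E >= 2, hence E - 1 >= E / 2; the second makes exp b |z|
    exceed R.\<close>
  define S where "S = max (2 powr (1 / (2 * c))) (R / exp b)"
  have "cmod z \<le> S" if FR: "cmod (F z) \<le> R" for z
  proof (rule ccontr)
    assume "\<not> cmod z \<le> S"
    then have z: "cmod z > 2 powr (1 / (2 * c))" "cmod z > R / exp b" by (auto simp: S_def)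
    have z1: "cmod z > 1"
      using z(1) c_pos ge_one_powr_ge_zero[of 2 "1 / (2 * c)"] by auto
    have "(2 powr (1 / (2 * c))) powr (2 * c) \<le> E z"
      unfolding E_def using z c_pos by (intro powr_mono2) auto
    then have E2: "E z \<ge> 2" using c_pos by (simp add: powr_powr)
    have "m * (E z / 2) \<le> cmod (p (mirror z)) * (E z - 1)"
      using w[OF mirror_cball[of z]] z1 E2 m by (intro mult_mono) (auto simp: m_def)
    then have "m / (2 * c) * E z \<le> (E z - 1) / c * cmod (p (mirror z))"
      using c_pos by (simp add: field_simps)
    also have "\<dots> = cmod (of_real ((E z - 1) / c) * p (mirror z))"
      using E2 c_pos by (simp only: norm_mult norm_of_real) simp
    also have "\<dots> \<le> cmod (X z)"
    proof -
      define u where "u = of_real ((E z - 1) / c) * p (mirror z)"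
      have "Re u \<ge> 0" using Re_X[of z] z1 by (simp add: X_alt u_def)
      then have "(cmod u)\<^sup>2 \<le> (cmod (1 + u))\<^sup>2"
        unfolding cmod_power2 by (simp add: power2_eq_square algebra_simps)
      then have "cmod u \<le> cmod (1 + u)" by (rule power2_le_imp_le) simp
      then show ?thesis by (simp add: X_alt u_def)
    qed
    finally have X: "m / (2 * c) * E z \<le> cmod (X z)" .
    have "ln (m / (2 * c)) + ln (E z) = ln (m / (2 * c) * E z)"
      using m c_pos E2 by (intro ln_mult_pos[symmetric]) auto
    also have "\<dots> \<le> ln (cmod (X z))"
      using X m c_pos E2 X_nonzero[of z] z1 by simp
    finally have "ln (m / (2 * c)) + 2 * c * ln (cmod z) \<le> ln (cmod (X z))"
      using z1 by (simp add: E_def ln_powr)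
    then have "(ln (m / (2 * c)) + 2 * c * ln (cmod z)) / c \<le> ln (cmod (X z)) / c"
      using c_pos by (intro divide_right_mono) auto
    then have lnX: "ln (m / (2 * c)) / c + 2 * ln (cmod z) \<le> ln (cmod (X z)) / c"
      using c_pos by (simp add: add_divide_distrib)
    \<comment> \<open>Here the choice of c enters, through Re (1 / s) = 1 / c.\<close>
    have "Re (Ln (X z) / s) = (ln (cmod (X z)) * \<alpha> + Im (Ln (X z)) * \<beta>) / (\<alpha>\<^sup>2 + \<beta>\<^sup>2)"
      using X_nonzero[of z] z1 by (simp add: Re_divide s_def)
    also have "\<dots> = ln (cmod (X z)) / c + Im (Ln (X z)) * \<beta> / (\<alpha>\<^sup>2 + \<beta>\<^sup>2)"
      using \<alpha> by (subst add_divide_distrib) (simp add: c_def)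
    finally have Re1: "Re (Ln (X z) / s) = ln (cmod (X z)) / c + Im (Ln (X z)) * \<beta> / (\<alpha>\<^sup>2 + \<beta>\<^sup>2)" .
    have "\<bar>Im (Ln (X z))\<bar> \<le> pi"
      using Im_Ln_le_pi mpi_less_Im_Ln X_nonzero[of z] z1 by (simp add: abs_le_iff less_imp_le minus_le_iff)
    then have "\<bar>Im (Ln (X z)) * \<beta>\<bar> \<le> pi * \<bar>\<beta>\<bar>"
      unfolding abs_mult by (rule mult_right_mono) simp
    then have "- (\<bar>\<beta>\<bar> * pi) \<le> Im (Ln (X z)) * \<beta>" by (simp add: abs_le_iff mult.commute)
    then have "- (\<bar>\<beta>\<bar> * pi) / (\<alpha>\<^sup>2 + \<beta>\<^sup>2) \<le> Im (Ln (X z)) * \<beta> / (\<alpha>\<^sup>2 + \<beta>\<^sup>2)"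
      by (rule divide_right_mono) simp
    then have "b + 2 * ln (cmod z) \<le> Re (L (mirror z) + Ln (X z) / s)"
      using v[OF mirror_cball[of z]] z1 lnX Re1 unfolding b_def by simp
    then have "exp (b + 2 * ln (cmod z)) / cmod z \<le> exp (Re (L (mirror z) + Ln (X z) / s)) / cmod z"
      by (intro divide_right_mono) auto
    also have "\<dots> = cmod (F z)"
      using z1 by (simp add: F_def F_out_def norm_mult mirror_def norm_inverse divide_inverse)
    also have "exp (b + 2 * ln (cmod z)) / cmod z = exp b * cmod z"
    proof -
      have "exp (ln (cmod z)) = cmod z" using z1 by (intro exp_ln) linarith
      then show ?thesis by (auto simp: exp_add exp_double power2_eq_square)
    qed
    finally have "exp b * cmod z \<le> R" using FR by simp
    then show False using z(2) by (simp add: field_simps)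
  qed
  then show ?thesis by blast
qed

theorem qc: "qc_automorphism k F"
proof -
  interpret C1_off_circle F A B k
  proof
    show "A 0 = 1" "B 0 = 0" by (simp_all add: A_def B_def L0 l0 p_def s_nonzero)
  qed (use k F_cont A_cont B_cont F_deriv A_nonzero BA F_eq_0 F_proper in auto)
  show ?thesis by (rule qc_automorphism)
qed

end

section \<open>Comparison of dilatations and reduction to the logarithms\<close>

lemma qc_automorphism_mono:
  assumes F: "qc_automorphism k F" and "k \<le> k'" "k' < 1"
  shows "qc_automorphism k' F"
proof -
  have "k * cmod w \<le> k' * cmod w" for w using assms by (intro mult_right_mono) auto
  then have le: "cmod v \<le> k * cmod w \<Longrightarrow> cmod v \<le> k' * cmod w" for v w using order_trans by blast
  have "AE p in lebesgue. \<exists>Fx Fy.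
        ((\<lambda>t::real. F (p + of_real t)) has_vector_derivative Fx) (at 0) \<and>
        ((\<lambda>t::real. F (p + \<i> * of_real t)) has_vector_derivative Fy) (at 0) \<and>
        cmod ((Fx + \<i> * Fy) / 2) \<le> k * cmod ((Fx - \<i> * Fy) / 2)"
    using F by (simp add: qc_automorphism_def)
  then have "AE p in lebesgue. \<exists>Fx Fy.
        ((\<lambda>t::real. F (p + of_real t)) has_vector_derivative Fx) (at 0) \<and>
        ((\<lambda>t::real. F (p + \<i> * of_real t)) has_vector_derivative Fy) (at 0) \<and>
        cmod ((Fx + \<i> * Fy) / 2) \<le> k' * cmod ((Fx - \<i> * Fy) / 2)"
    by (rule AE_mp) (intro AE_I2 impI, meson le)
  then show ?thesis using assms unfolding qc_automorphism_def by (meson order_trans)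
qed

text \<open>After clearing the denominator, k <= k' becomes k r <= k alpha + |beta|, which follows
  from r <= alpha + |beta| and k < 1. The strict bound k' < 1 comes from 2 k < 1 + k^2 and |beta| <=
  r.\<close>

lemma dilatation_bounds:
  fixes \<alpha> \<beta> k :: real
  assumes "\<alpha> > 0" "0 \<le> k" "k < 1"
  defines "k' \<equiv> (2 * k * \<alpha> + (1 - k\<^sup>2) * \<bar>\<beta>\<bar>) / ((1 + k\<^sup>2) * \<alpha> + (1 - k\<^sup>2) * sqrt (\<alpha>\<^sup>2 + \<beta>\<^sup>2))"
  shows "k \<le> k'" "k' < 1"
proof -
  define r where "r = sqrt (\<alpha>\<^sup>2 + \<beta>\<^sup>2)"
  have k2: "1 - k\<^sup>2 > 0" using assms by (simp add: power_less_one_iff abs_square_less_1)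
  have r: "\<bar>\<beta>\<bar> \<le> r" "r \<le> \<alpha> + \<bar>\<beta>\<bar>"
    using sqrt_sum_squares_le_sum_abs[of \<alpha> \<beta>] assms(1) by (auto simp: r_def intro: real_le_rsqrt)
  have pos: "(1 + k\<^sup>2) * \<alpha> + (1 - k\<^sup>2) * r > 0"
    using assms(1) k2 r by (intro add_pos_nonneg mult_pos_pos mult_nonneg_nonneg) (auto simp: add_pos_nonneg)
  have "k * r \<le> k * \<alpha> + 1 * \<bar>\<beta>\<bar>"
    using mult_left_mono[OF r(2) assms(2)] mult_right_mono[of k 1 "\<bar>\<beta>\<bar>"] assms by (simp add: distrib_left)
  then have "(1 - k\<^sup>2) * (k * r) \<le> (1 - k\<^sup>2) * (k * \<alpha> + \<bar>\<beta>\<bar>)"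
    using k2 by (intro mult_left_mono) auto
  then have "k * ((1 + k\<^sup>2) * \<alpha> + (1 - k\<^sup>2) * r) \<le> 2 * k * \<alpha> + (1 - k\<^sup>2) * \<bar>\<beta>\<bar>"
    by (simp add: algebra_simps power2_eq_square)
  then show "k \<le> k'" using pos unfolding k'_def r_def[symmetric] by (simp add: pos_le_divide_eq)
  have "0 < (1 - k)\<^sup>2 * \<alpha>" using assms by simp
  then have "2 * k * \<alpha> < (1 + k\<^sup>2) * \<alpha>" by (simp add: power2_eq_square algebra_simps)
  moreover have "(1 - k\<^sup>2) * \<bar>\<beta>\<bar> \<le> (1 - k\<^sup>2) * r" using k2 r by (intro mult_left_mono) auto
  ultimately show "k' < 1" using pos unfolding k'_def r_def[symmetric] by simp
qed

text \<open>The values of L and l on the circle are arbitrary, so the closed-disc construction is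
  applied to continuous representatives. These agree on the open disc, hence so do the derivatives
  and all hypotheses.\<close>

lemma (in bazilevich_data) qc_extension:
  "\<exists>F. qc_automorphism k F \<and> (\<forall>z\<in>ball 0 1. F z = z * exp (L z))"
proof -
  obtain B B' where "\<And>x y. x \<in> ball 0 1 \<Longrightarrow> y \<in> ball 0 1 \<Longrightarrow> cmod (L x - L y) \<le> B * cmod (x - y)"
    and "\<And>x y. x \<in> ball 0 1 \<Longrightarrow> y \<in> ball 0 1 \<Longrightarrow> cmod (l x - l y) \<le> B' * cmod (x - y)"
    using L_lipschitz l_lipschitz by metis
  then obtain L' l' where L': "continuous_on (cball 0 1) L'" "\<And>z. z \<in> ball 0 1 \<Longrightarrow> L' z = L z"
    and l': "continuous_on (cball 0 1) l'" "\<And>z. z \<in> ball 0 1 \<Longrightarrow> l' z = l z"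
    using continuous_extension[of L B] continuous_extension[of l B'] by metis
  have hol: "L' holomorphic_on ball 0 1" "l' holomorphic_on ball 0 1"
    using holomorphic_transform[OF L] holomorphic_transform[OF l] L' l' by metis+
  have deriv: "deriv L' z = deriv L z" "deriv l' z = deriv l z" if "z \<in> ball 0 1" for z
    using that L' l' hol L l by (auto intro!: complex_derivative_transform_within_open[of _ "ball 0 1"])
  interpret ext: bazilevich_closed \<alpha> \<beta> k L' l'
  proof
    show "exp (l' z - Complex \<alpha> \<beta> * L' z) = 1 + z * deriv L' z" if "z \<in> ball 0 1" for z
      using key that L' l' deriv by simp
    show "cmod (Complex \<alpha> \<beta> + z * deriv l' z - of_real ((\<alpha>\<^sup>2 + \<beta>\<^sup>2) / \<alpha>)) \<le> k * ((\<alpha>\<^sup>2 + \<beta>\<^sup>2) / \<alpha>)"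
      if "z \<in> ball 0 1" for z
      using bound[OF that] deriv[OF that] by simp
  qed (use \<alpha> k hol L' l' L0 l0 in auto)
  have "ext.F z = z * exp (L z)" if "z \<in> ball 0 1" for z
    using that L'(2)[OF that] by (simp add: ext.F_def)
  then show ?thesis using ext.qc by blast
qed

lemma holomorphic_log_of_quotient:
  assumes f: "class_A f" and nz: "\<And>z. z \<in> ball 0 1 \<Longrightarrow> z \<noteq> 0 \<Longrightarrow> f z \<noteq> 0"
  obtains L where "L holomorphic_on ball 0 1" "L 0 = 0" "\<And>z. z \<in> ball 0 1 \<Longrightarrow> f z = z * exp (L z)"
proof -
  have fh: "f holomorphic_on ball 0 1" "f 0 = 0" "deriv f 0 = 1" using f by (auto simp: class_A_def unit_disc_def)
  define \<phi> where "\<phi> z = (if z = 0 then 1 else f z / z)" for z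
  have "\<phi> holomorphic_on ball 0 1"
    by (rule pole_theorem_open_0[OF fh(1), where a = 0]) (auto simp: \<phi>_def fh)
  moreover have "\<phi> z \<noteq> 0" if "z \<in> ball 0 1" for z using nz[OF that] by (auto simp: \<phi>_def)
  ultimately obtain g where g: "g holomorphic_on ball 0 1" "\<And>z. z \<in> ball 0 1 \<Longrightarrow> exp (g z) = \<phi> z"
    using holomorphic_logarithm_exists[of "ball 0 1" \<phi> 0] by auto
  show thesis
  \<comment> \<open>\<open>g 0\<close> is a logarithm of 1, possibly a nonzero multiple of 2 pi i;
    subtracting it normalises without changing the exponential.\<close>
  proof (rule that[of "\<lambda>z. g z - g 0"])
    show "(\<lambda>z. g z - g 0) holomorphic_on ball 0 1" by (intro holomorphic_intros g)
    fix z :: complex assume "z \<in> ball 0 1"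
    then show "f z = z * exp (g z - g 0)" using g(2)[of z] g(2)[of 0] by (auto simp: exp_diff \<phi>_def fh)
  qed simp
qed

theorem theorem2:
  fixes \<alpha> \<beta> k :: real and f :: "complex \<Rightarrow> complex"
  assumes "\<alpha> > 0" and "0 \<le> k" and "k < 1"
    and "class_A f"
    and "\<forall>z\<in>unit_disc. deriv f z \<noteq> 0 \<and> (z \<noteq> 0 \<longrightarrow> f z \<noteq> 0)"
    and "\<forall>z\<in>unit_disc.
           cmod (1 + z * deriv (deriv f) z / deriv f z
                 + (Complex \<alpha> \<beta> - 1) * (if z = 0 then 1 else z * deriv f z / f z)
                 - of_real ((\<alpha>\<^sup>2 + \<beta>\<^sup>2) / \<alpha>))
           \<le> (if \<alpha> < \<alpha>\<^sup>2 + \<beta>\<^sup>2 then k else k * (\<alpha>\<^sup>2 + \<beta>\<^sup>2) / \<alpha>)"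
  shows "bazilevich \<alpha> \<beta> f \<and>
         (\<exists>F. qc_automorphism
                ((2 * k * \<alpha> + (1 - k\<^sup>2) * \<bar>\<beta>\<bar>) /
                 ((1 + k\<^sup>2) * \<alpha> + (1 - k\<^sup>2) * sqrt (\<alpha>\<^sup>2 + \<beta>\<^sup>2))) F
              \<and> (\<forall>z\<in>unit_disc. F z = f z))"
proof -
  define s where "s = Complex \<alpha> \<beta>"
  have fh: "f holomorphic_on ball 0 1" "deriv f 0 = 1" using assms(4) by (auto simp: class_A_def unit_disc_def)
  have nz: "deriv f z \<noteq> 0" "z \<noteq> 0 \<Longrightarrow> f z \<noteq> 0" if "z \<in> ball 0 1" for z
    using assms(5) that by (auto simp: unit_disc_def)
  obtain L where L: "L holomorphic_on ball 0 1" "L 0 = 0" and f_eq: "\<And>z. z \<in> ball 0 1 \<Longrightarrow> f z = z * exp (L z)"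
    using holomorphic_log_of_quotient[OF assms(4) nz(2)] by blast
  have "deriv f holomorphic_on ball 0 1" using fh(1) by (rule holomorphic_deriv) simp
  then obtain g where g: "g holomorphic_on ball 0 1" "\<And>z. z \<in> ball 0 1 \<Longrightarrow> exp (g z) = deriv f z"
    using holomorphic_logarithm_exists[of "ball 0 1" "deriv f" 0] nz(1) by auto
  define d where "d z = g z - g 0" for z
  have d: "d holomorphic_on ball 0 1" unfolding d_def by (intro holomorphic_intros g)
  have exp_d: "exp (d z) = deriv f z" if "z \<in> ball 0 1" for z
    using g(2)[OF that] g(2)[of 0] by (simp add: d_def exp_diff fh)
  \<comment> \<open>The normalised logarithm of f' (f(z) / z)^(s - 1), as \<open>d\<close> is that
    of f'.\<close>
  define l where "l z = (s - 1) * L z + d z" for z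
  have dL: "(L has_field_derivative deriv L z) (at z)" and dd: "(d has_field_derivative deriv d z) (at z)"
    if "z \<in> ball 0 1" for z
    using L(1) d that by (auto intro: holomorphic_derivI)
  have f': "deriv f z = exp (L z) * (1 + z * deriv L z)" if z: "z \<in> ball 0 1" for z
  proof -
    have "((\<lambda>z. z * exp (L z)) has_field_derivative exp (L z) * (1 + z * deriv L z)) (at z)"
      by (auto intro!: derivative_eq_intros dL[OF z] simp: algebra_simps)
    then have "(f has_field_derivative exp (L z) * (1 + z * deriv L z)) (at z)"
      by (rule has_field_derivative_transform_within_open[OF _ open_ball z]) (simp add: f_eq)
    then show ?thesis by (rule DERIV_imp_deriv)
  qed
  have f'': "deriv (deriv f) z = deriv f z * deriv d z" if z: "z \<in> ball 0 1" for z
  proof -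
    have "((\<lambda>z. exp (d z)) has_field_derivative exp (d z) * deriv d z) (at z)"
      by (auto intro!: derivative_eq_intros dd[OF z])
    then have "(deriv f has_field_derivative exp (d z) * deriv d z) (at z)"
      by (rule has_field_derivative_transform_within_open[OF _ open_ball z]) (simp add: exp_d)
    then show ?thesis using exp_d[OF z] by (simp add: DERIV_imp_deriv)
  qed
  interpret bazilevich_data \<alpha> \<beta> k L l
  proof
    show "l holomorphic_on ball 0 1" unfolding l_def by (intro holomorphic_intros L d)
    show "l 0 = 0" by (simp add: l_def d_def L)
    fix z :: complex assume z: "z \<in> ball 0 1"
    have "exp (l z - s * L z) = exp (d z) / exp (L z)" by (simp add: l_def exp_diff algebra_simps)
    then show "exp (l z - Complex \<alpha> \<beta> * L z) = 1 + z * deriv L z"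
      using exp_d[OF z] f'[OF z] by (simp add: s_def)
    have "(l has_field_derivative (s - 1) * deriv L z + deriv d z) (at z)"
      unfolding l_def by (auto intro!: derivative_eq_intros dL[OF z] dd[OF z])
    then have dl: "deriv l z = (s - 1) * deriv L z + deriv d z" by (rule DERIV_imp_deriv)
    have Q1: "z * deriv (deriv f) z / deriv f z = z * deriv d z"
      using f''[OF z] nz(1)[OF z] by simp
    have Q2: "(if z = 0 then 1 else z * deriv f z / f z) = 1 + z * deriv L z"
      using f'[OF z] f_eq[OF z] by simp
    have "s + z * deriv l z = 1 + z * deriv (deriv f) z / deriv f z
        + (s - 1) * (if z = 0 then 1 else z * deriv f z / f z)"
      unfolding dl Q1 Q2 by (simp add: algebra_simps)
    then have "cmod (s + z * deriv l z - of_real ((\<alpha>\<^sup>2 + \<beta>\<^sup>2) / \<alpha>))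
        \<le> (if \<alpha> < \<alpha>\<^sup>2 + \<beta>\<^sup>2 then k else k * (\<alpha>\<^sup>2 + \<beta>\<^sup>2) / \<alpha>)"
      using assms(6) z unfolding unit_disc_def s_def by metis
    \<comment> \<open>If alpha < alpha^2 + beta^2, then c > 1 and k <= k c; otherwise the two sides
      agree.\<close>
    also have "\<dots> \<le> k * ((\<alpha>\<^sup>2 + \<beta>\<^sup>2) / \<alpha>)"
      using assms(1,2) mult_left_mono[of 1 "(\<alpha>\<^sup>2 + \<beta>\<^sup>2) / \<alpha>" k] by auto
    finally show "cmod (Complex \<alpha> \<beta> + z * deriv l z - of_real ((\<alpha>\<^sup>2 + \<beta>\<^sup>2) / \<alpha>)) \<le> k * ((\<alpha>\<^sup>2 + \<beta>\<^sup>2) / \<alpha>)"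
      unfolding s_def .
  qed (use assms L in auto)
  obtain F where "qc_automorphism k F" "\<forall>z\<in>ball 0 1. F z = z * exp (L z)"
    using qc_extension by blast
  then show ?thesis
    using bazilevich[OF assms(4) f_eq] qc_automorphism_mono[OF _ dilatation_bounds[OF assms(1-3)]] f_eq
    by (auto simp: unit_disc_def)
qed

end
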